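(* Let $M$ be a special inverse monoid defined by a special inverse monoid presentation $\langle X \mid R \rangle$ in which some generator $v \in X$ represents neither a left unit nor a right unit of $M$. Then $M$ contains every finite subgroup of its group of units as a maximal subgroup; that is, for every finite subgroup $Q$ of the group of units of $M$ there is a maximal subgroup of $M$ isomorphic to $Q$.
   Context: An inverse monoid presentation $\langle X \mid R\rangle$ (with $X$, $R$ possibly infinite) defines the quotient of the free inverse monoid on $X$ by the congruence generated by $R$. The presentation is special if every defining relation has the form $r=1$ with $r$ a word over $X^{\pm1} = X \cup \{x^{-1} : x \in X\}$; an inverse monoid is special if it admits such a presentation. An element $m\in M$ is a right unit if $mm^{-1}=1$ (equivalently $m \mathrel{\mathcal{R}} 1$) and a left unit if $m^{-1}m=1$ (equivalently $m \mathrel{\mathcal{L}} 1$). The maximal subgroups of $M$ are the group $\mathcal{H}$-classes, i.e. the $\mathcal{H}$-classes of idempotents; the group of units is the $\mathcal{H}$-class of $1$. *)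

theory Defs
  imports "HOL-Algebra.Coset"
begin

section \<open>Congruences on a monoid and quotients\<close>

inductive_set gen_cong :: "('a, 'm) monoid_scheme \<Rightarrow> ('a \<times> 'a) set \<Rightarrow> ('a \<times> 'a) set"
  for M (structure) and S where
  base:  "(a, b) \<in> S \<Longrightarrow> a \<in> carrier M \<Longrightarrow> b \<in> carrier M \<Longrightarrow> (a, b) \<in> gen_cong M S"
| refl:  "a \<in> carrier M \<Longrightarrow> (a, a) \<in> gen_cong M S"
| sym:   "(a, b) \<in> gen_cong M S \<Longrightarrow> (b, a) \<in> gen_cong M S"
| trans: "(a, b) \<in> gen_cong M S \<Longrightarrow> (b, c) \<in> gen_cong M S \<Longrightarrow> (a, c) \<in> gen_cong M S"
| mult:  "(a, b) \<in> gen_cong M S \<Longrightarrow> (c, d) \<in> gen_cong M S \<Longrightarrow>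
            (a \<otimes> c, b \<otimes> d) \<in> gen_cong M S"

text \<open>For a congruence \<open>\<rho>\<close>, the setwise product of two classes is contained in a single class;
  taking the image under \<open>\<rho>\<close> yields that class.\<close>

definition quot_monoid :: "('a, 'm) monoid_scheme \<Rightarrow> ('a \<times> 'a) set \<Rightarrow> 'a set monoid" where
  "quot_monoid M \<rho> =
     \<lparr> carrier = carrier M // \<rho>,
       mult = (\<lambda>A B. \<rho> `` (A <#>\<^bsub>M\<^esub> B)),
       one = \<rho> `` {\<one>\<^bsub>M\<^esub>} \<rparr>"

section \<open>Inverse monoids and Green's relations\<close>

definition inverse_monoid :: "('a, 'm) monoid_scheme \<Rightarrow> bool" where
  "inverse_monoid M \<longleftrightarrow> monoid M \<and>
     (\<forall>m \<in> carrier M. \<exists>!n. n \<in> carrier M \<and>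
        m \<otimes>\<^bsub>M\<^esub> n \<otimes>\<^bsub>M\<^esub> m = m \<and> n \<otimes>\<^bsub>M\<^esub> m \<otimes>\<^bsub>M\<^esub> n = n)"

text \<open>The inverse of inverse semigroup theory, which HOL-Algebra's \<open>inv\<close> (two-sided inverses of
  units) does not provide.\<close>

definition sinv :: "('a, 'm) monoid_scheme \<Rightarrow> 'a \<Rightarrow> 'a" where
  "sinv M m = (THE n. n \<in> carrier M \<and>
     m \<otimes>\<^bsub>M\<^esub> n \<otimes>\<^bsub>M\<^esub> m = m \<and> n \<otimes>\<^bsub>M\<^esub> m \<otimes>\<^bsub>M\<^esub> n = n)"

definition right_unit :: "('a, 'm) monoid_scheme \<Rightarrow> 'a \<Rightarrow> bool" where
  "right_unit M m \<longleftrightarrow> m \<in> carrier M \<and> m \<otimes>\<^bsub>M\<^esub> sinv M m = \<one>\<^bsub>M\<^esub>"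

definition left_unit :: "('a, 'm) monoid_scheme \<Rightarrow> 'a \<Rightarrow> bool" where
  "left_unit M m \<longleftrightarrow> m \<in> carrier M \<and> sinv M m \<otimes>\<^bsub>M\<^esub> m = \<one>\<^bsub>M\<^esub>"

definition green_R :: "('a, 'm) monoid_scheme \<Rightarrow> 'a \<Rightarrow> 'a \<Rightarrow> bool" where
  "green_R M a b \<longleftrightarrow> a \<in> carrier M \<and> b \<in> carrier M \<and>
     (\<lambda>x. a \<otimes>\<^bsub>M\<^esub> x) ` carrier M = (\<lambda>x. b \<otimes>\<^bsub>M\<^esub> x) ` carrier M"

definition green_L :: "('a, 'm) monoid_scheme \<Rightarrow> 'a \<Rightarrow> 'a \<Rightarrow> bool" where
  "green_L M a b \<longleftrightarrow> a \<in> carrier M \<and> b \<in> carrier M \<and>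
     (\<lambda>x. x \<otimes>\<^bsub>M\<^esub> a) ` carrier M = (\<lambda>x. x \<otimes>\<^bsub>M\<^esub> b) ` carrier M"

definition H_class :: "('a, 'm) monoid_scheme \<Rightarrow> 'a \<Rightarrow> 'a set" where
  "H_class M a = {b. green_R M a b \<and> green_L M a b}"

text \<open>The maximal subgroup with identity \<open>e\<close>, for an idempotent \<open>e\<close>.\<close>

definition maximal_subgroup :: "('a, 'm) monoid_scheme \<Rightarrow> 'a \<Rightarrow> 'a monoid" where
  "maximal_subgroup M e = \<lparr> carrier = H_class M e, mult = mult M, one = e \<rparr>"

section \<open>Inverse monoid presentations\<close>

text \<open>A word over \<open>X\<^sup>\<plusminus>\<^sup>1\<close> is a list of pairs: \<open>(x, True)\<close> stands for \<open>x\<close> and \<open>(x, False)\<close>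
  for \<open>x\<^sup>-\<^sup>1\<close>.\<close>

type_synonym 'a word = "('a \<times> bool) list"

definition words :: "'a set \<Rightarrow> 'a word set" where
  "words X = lists (X \<times> UNIV)"

definition word_inv :: "'a word \<Rightarrow> 'a word" where
  "word_inv w = rev (map (\<lambda>(x, b). (x, \<not> b)) w)"

definition word_monoid :: "'a set \<Rightarrow> 'a word monoid" where
  "word_monoid X = \<lparr> carrier = words X, mult = (@), one = [] \<rparr>"

text \<open>The Vagner congruence, whose quotient is the free inverse monoid on \<open>X\<close>.\<close>

definition vagner_cong :: "'a set \<Rightarrow> ('a word \<times> 'a word) set" where
  "vagner_cong X = gen_cong (word_monoid X)
     ({(w @ word_inv w @ w, w) | w. w \<in> words X} \<union>
      {(u @ word_inv u @ w @ word_inv w, w @ word_inv w @ u @ word_inv u)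
         | u w. u \<in> words X \<and> w \<in> words X})"

definition free_inverse_monoid :: "'a set \<Rightarrow> 'a word set monoid" where
  "free_inverse_monoid X = quot_monoid (word_monoid X) (vagner_cong X)"

definition fim_elem :: "'a set \<Rightarrow> 'a word \<Rightarrow> 'a word set" where
  "fim_elem X w = vagner_cong X `` {w}"

text \<open>A pair \<open>(u, v) \<in> R\<close> is the defining relation \<open>u = v\<close>.\<close>

definition relator_cong ::
    "'a set \<Rightarrow> ('a word \<times> 'a word) set \<Rightarrow> ('a word set \<times> 'a word set) set" where
  "relator_cong X R = gen_cong (free_inverse_monoid X)
     {(fim_elem X u, fim_elem X v) | u v. (u, v) \<in> R}"

definition presented_monoid ::
    "'a set \<Rightarrow> ('a word \<times> 'a word) set \<Rightarrow> 'a word set set monoid" where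
  "presented_monoid X R = quot_monoid (free_inverse_monoid X) (relator_cong X R)"

definition presented_elem ::
    "'a set \<Rightarrow> ('a word \<times> 'a word) set \<Rightarrow> 'a word \<Rightarrow> 'a word set set" where
  "presented_elem X R w = relator_cong X R `` {fim_elem X w}"

definition special_presentation :: "'a set \<Rightarrow> ('a word \<times> 'a word) set \<Rightarrow> bool" where
  "special_presentation X R \<longleftrightarrow> (\<forall>(u, v) \<in> R. u \<in> words X \<and> v = [])"

section \<open>Well-definedness\<close>

definition congruence :: "('a, 'm) monoid_scheme \<Rightarrow> ('a \<times> 'a) set \<Rightarrow> bool" where
  "congruence M \<rho> \<longleftrightarrow> equiv (carrier M) \<rho> \<and>
     (\<forall>a b c d. (a, b) \<in> \<rho> \<longrightarrow> (c, d) \<in> \<rho> \<longrightarrow> (a \<otimes>\<^bsub>M\<^esub> c, b \<otimes>\<^bsub>M\<^esub> d) \<in> \<rho>)"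

lemma gen_cong_carrier:
  assumes "monoid M" "(a, b) \<in> gen_cong M S"
  shows "a \<in> carrier M \<and> b \<in> carrier M"
  using assms(2) by induction (auto simp: monoid.m_closed[OF assms(1)])

lemma gen_cong_congruence:
  assumes "monoid M"
  shows "congruence M (gen_cong M S)"
  unfolding congruence_def
proof (intro conjI allI impI equivI)
  show "gen_cong M S \<subseteq> carrier M \<times> carrier M"
    using gen_cong_carrier[OF assms] by auto
  show "refl_on (carrier M) (gen_cong M S)" by (rule refl_onI) (rule gen_cong.refl)
  show "sym (gen_cong M S)" by (rule symI) (rule gen_cong.sym)
  show "trans (gen_cong M S)" by (rule transI) (rule gen_cong.trans)
qed (rule gen_cong.mult)

lemma gen_cong_least:
  assumes "congruence M \<rho>" "S \<subseteq> \<rho>"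
  shows "gen_cong M S \<subseteq> \<rho>"
proof -
  have "(a, b) \<in> \<rho>" if "(a, b) \<in> gen_cong M S" for a b
    using that
  proof induction
    case (base a b)
    then show ?case using assms(2) by blast
  next
    case (refl a)
    then show ?case using assms(1) by (auto simp: congruence_def equiv_def refl_on_def)
  next
    case (sym a b)
    then show ?case using assms(1) by (auto simp: congruence_def equiv_def dest: symD)
  next
    case (trans a b c)
    then show ?case using assms(1) unfolding congruence_def equiv_def by (blast dest: transD)
  next
    case (mult a b c d)
    then show ?case using assms(1) by (auto simp: congruence_def)
  qed
  then show ?thesis by auto
qed

lemma quot_mult:
  assumes "monoid M" "congruence M \<rho>" "a \<in> carrier M" "b \<in> carrier M"
  shows "\<rho> `` {a} \<otimes>\<^bsub>quot_monoid M \<rho>\<^esub> \<rho> `` {b} = \<rho> `` {a \<otimes>\<^bsub>M\<^esub> b}"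
proof -
  have eq: "equiv (carrier M) \<rho>"
    and m: "\<And>a b c d. (a, b) \<in> \<rho> \<Longrightarrow> (c, d) \<in> \<rho> \<Longrightarrow> (a \<otimes>\<^bsub>M\<^esub> c, b \<otimes>\<^bsub>M\<^esub> d) \<in> \<rho>"
    using assms(2) unfolding congruence_def by blast+
  have "(a, a) \<in> \<rho>" "(b, b) \<in> \<rho>"
    using eq assms(3,4) by (auto simp: equiv_def refl_on_def)
  moreover have "sym \<rho>" "trans \<rho>" using eq by (auto simp: equiv_def)
  ultimately show ?thesis
    unfolding quot_monoid_def set_mult_def by (auto intro: transD[OF _ m])
qed

lemma quot_carrier: "A \<in> carrier (quot_monoid M \<rho>) \<longleftrightarrow> (\<exists>a \<in> carrier M. A = \<rho> `` {a})"
  by (auto simp: quot_monoid_def quotient_def)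

lemma monoid_quot:
  assumes "monoid M" "congruence M \<rho>"
  shows "monoid (quot_monoid M \<rho>)"
proof -
  interpret M: monoid M by fact
  have one: "\<one>\<^bsub>quot_monoid M \<rho>\<^esub> = \<rho> `` {\<one>\<^bsub>M\<^esub>}" by (simp add: quot_monoid_def)
  note qm = quot_mult[OF assms]
  show ?thesis
  proof (rule monoidI)
    fix A B assume "A \<in> carrier (quot_monoid M \<rho>)" "B \<in> carrier (quot_monoid M \<rho>)"
    then obtain a b where "a \<in> carrier M" "b \<in> carrier M" "A = \<rho> `` {a}" "B = \<rho> `` {b}"
      unfolding quot_carrier by blast
    then show "A \<otimes>\<^bsub>quot_monoid M \<rho>\<^esub> B \<in> carrier (quot_monoid M \<rho>)"
      unfolding quot_carrier by (intro bexI[of _ "a \<otimes>\<^bsub>M\<^esub> b"]) (simp_all add: qm)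
  next
    show "\<one>\<^bsub>quot_monoid M \<rho>\<^esub> \<in> carrier (quot_monoid M \<rho>)"
      unfolding quot_carrier one by blast
  next
    fix A B C assume "A \<in> carrier (quot_monoid M \<rho>)" "B \<in> carrier (quot_monoid M \<rho>)"
      "C \<in> carrier (quot_monoid M \<rho>)"
    then obtain a b c where "a \<in> carrier M" "b \<in> carrier M" "c \<in> carrier M"
      "A = \<rho> `` {a}" "B = \<rho> `` {b}" "C = \<rho> `` {c}"
      unfolding quot_carrier by blast
    then show "A \<otimes>\<^bsub>quot_monoid M \<rho>\<^esub> B \<otimes>\<^bsub>quot_monoid M \<rho>\<^esub> C =
        A \<otimes>\<^bsub>quot_monoid M \<rho>\<^esub> (B \<otimes>\<^bsub>quot_monoid M \<rho>\<^esub> C)"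
      by (simp add: qm M.m_assoc)
  next
    fix A assume "A \<in> carrier (quot_monoid M \<rho>)"
    then obtain a where a: "a \<in> carrier M" "A = \<rho> `` {a}" unfolding quot_carrier by blast
    then show "\<one>\<^bsub>quot_monoid M \<rho>\<^esub> \<otimes>\<^bsub>quot_monoid M \<rho>\<^esub> A = A"
      by (simp add: qm one)
    show "A \<otimes>\<^bsub>quot_monoid M \<rho>\<^esub> \<one>\<^bsub>quot_monoid M \<rho>\<^esub> = A"
      using a by (simp add: qm one)
  qed
qed

text \<open>Existence of a \<open>regular_op\<close> is equivalent to being an inverse monoid, and evidently passes
  to quotients.\<close>

definition regular_op :: "('a, 'm) monoid_scheme \<Rightarrow> ('a \<Rightarrow> 'a) \<Rightarrow> bool" where
  "regular_op M i \<longleftrightarrow> (\<forall>m \<in> carrier M. i m \<in> carrier M \<and>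
      m \<otimes>\<^bsub>M\<^esub> i m \<otimes>\<^bsub>M\<^esub> m = m \<and> i m \<otimes>\<^bsub>M\<^esub> m \<otimes>\<^bsub>M\<^esub> i m = i m) \<and>
    (\<forall>e \<in> (\<Union>m \<in> carrier M. {m \<otimes>\<^bsub>M\<^esub> i m, i m \<otimes>\<^bsub>M\<^esub> m}).
     \<forall>f \<in> (\<Union>m \<in> carrier M. {m \<otimes>\<^bsub>M\<^esub> i m, i m \<otimes>\<^bsub>M\<^esub> m}). e \<otimes>\<^bsub>M\<^esub> f = f \<otimes>\<^bsub>M\<^esub> e)"

lemma regular_op_inverse_monoid:
  assumes "monoid M" "regular_op M i"
  shows "inverse_monoid M"
proof -
  interpret monoid M by fact
  define E where "E = (\<Union>m \<in> carrier M. {m \<otimes>\<^bsub>M\<^esub> i m, i m \<otimes>\<^bsub>M\<^esub> m})"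
  have i: "i m \<in> carrier M" "m \<otimes>\<^bsub>M\<^esub> i m \<otimes>\<^bsub>M\<^esub> m = m" "i m \<otimes>\<^bsub>M\<^esub> m \<otimes>\<^bsub>M\<^esub> i m = i m"
    if "m \<in> carrier M" for m
    using assms(2) that by (simp_all add: regular_op_def)
  have E: "e \<otimes>\<^bsub>M\<^esub> f = f \<otimes>\<^bsub>M\<^esub> e" if "e \<in> E" "f \<in> E" for e f
    using assms(2) that unfolding regular_op_def E_def by blast
  have idem: "e \<in> E" if e: "e \<in> carrier M" "e \<otimes>\<^bsub>M\<^esub> e = e" for e
  proof -
    define f where "f = i e"
    have f: "f \<in> carrier M" "e \<otimes>\<^bsub>M\<^esub> f \<otimes>\<^bsub>M\<^esub> e = e" "f \<otimes>\<^bsub>M\<^esub> e \<otimes>\<^bsub>M\<^esub> f = f"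
      using i[OF e(1)] by (simp_all add: f_def)
    have ee: "e \<otimes>\<^bsub>M\<^esub> (e \<otimes>\<^bsub>M\<^esub> x) = e \<otimes>\<^bsub>M\<^esub> x" if "x \<in> carrier M" for x
      using m_assoc[of e e x] e that by simp
    have "f = (f \<otimes>\<^bsub>M\<^esub> e) \<otimes>\<^bsub>M\<^esub> (e \<otimes>\<^bsub>M\<^esub> f)"
      using e f ee by (simp add: m_assoc)
    also have "\<dots> = (e \<otimes>\<^bsub>M\<^esub> f) \<otimes>\<^bsub>M\<^esub> (f \<otimes>\<^bsub>M\<^esub> e)"
      by (rule E) (use e in \<open>auto simp: E_def f_def\<close>)
    finally have f': "f = (e \<otimes>\<^bsub>M\<^esub> f) \<otimes>\<^bsub>M\<^esub> (f \<otimes>\<^bsub>M\<^esub> e)" .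
    have "e \<otimes>\<^bsub>M\<^esub> f = e \<otimes>\<^bsub>M\<^esub> ((e \<otimes>\<^bsub>M\<^esub> f) \<otimes>\<^bsub>M\<^esub> (f \<otimes>\<^bsub>M\<^esub> e))"
      using f' by (rule arg_cong)
    also have "\<dots> = (e \<otimes>\<^bsub>M\<^esub> f) \<otimes>\<^bsub>M\<^esub> (f \<otimes>\<^bsub>M\<^esub> e)"
      using e f(1) ee by (simp add: m_assoc)
    finally have ef: "e \<otimes>\<^bsub>M\<^esub> f = f" unfolding f'[symmetric] .
    have "f \<otimes>\<^bsub>M\<^esub> e = ((e \<otimes>\<^bsub>M\<^esub> f) \<otimes>\<^bsub>M\<^esub> (f \<otimes>\<^bsub>M\<^esub> e)) \<otimes>\<^bsub>M\<^esub> e"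
      using f' by (rule arg_cong)
    also have "\<dots> = (e \<otimes>\<^bsub>M\<^esub> f) \<otimes>\<^bsub>M\<^esub> (f \<otimes>\<^bsub>M\<^esub> e)"
      using e f(1) by (simp add: m_assoc)
    finally have fe: "f \<otimes>\<^bsub>M\<^esub> e = f" unfolding f'[symmetric] .
    have "e = f" using f(2) ef fe by simp
    then have "e = e \<otimes>\<^bsub>M\<^esub> i e" using e(2) unfolding f_def by simp
    then show ?thesis using e(1) unfolding E_def by blast
  qed
  have uniq: "n = n'"
    if m: "m \<in> carrier M"
      and n: "n \<in> carrier M" "m \<otimes>\<^bsub>M\<^esub> n \<otimes>\<^bsub>M\<^esub> m = m" "n \<otimes>\<^bsub>M\<^esub> m \<otimes>\<^bsub>M\<^esub> n = n"
      and n': "n' \<in> carrier M" "m \<otimes>\<^bsub>M\<^esub> n' \<otimes>\<^bsub>M\<^esub> m = m" "n' \<otimes>\<^bsub>M\<^esub> m \<otimes>\<^bsub>M\<^esub> n' = n'"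
    for m n n'
  proof -
    have id: "m \<otimes>\<^bsub>M\<^esub> p \<in> E" "p \<otimes>\<^bsub>M\<^esub> m \<in> E"
      if p: "p \<in> carrier M" "m \<otimes>\<^bsub>M\<^esub> p \<otimes>\<^bsub>M\<^esub> m = m" for p
    proof -
      have "(m \<otimes>\<^bsub>M\<^esub> p) \<otimes>\<^bsub>M\<^esub> (m \<otimes>\<^bsub>M\<^esub> p) = (m \<otimes>\<^bsub>M\<^esub> p \<otimes>\<^bsub>M\<^esub> m) \<otimes>\<^bsub>M\<^esub> p"
        using m p(1) by (simp add: m_assoc)
      then show "m \<otimes>\<^bsub>M\<^esub> p \<in> E" using m p by (intro idem) simp_all
      have "(p \<otimes>\<^bsub>M\<^esub> m) \<otimes>\<^bsub>M\<^esub> (p \<otimes>\<^bsub>M\<^esub> m) = p \<otimes>\<^bsub>M\<^esub> (m \<otimes>\<^bsub>M\<^esub> p \<otimes>\<^bsub>M\<^esub> m)"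
        using m p(1) by (simp add: m_assoc)
      then show "p \<otimes>\<^bsub>M\<^esub> m \<in> E" using m p by (intro idem) simp_all
    qed
    have "n = n \<otimes>\<^bsub>M\<^esub> (m \<otimes>\<^bsub>M\<^esub> n' \<otimes>\<^bsub>M\<^esub> m) \<otimes>\<^bsub>M\<^esub> n" using n n' by simp
    also have "\<dots> = n \<otimes>\<^bsub>M\<^esub> ((m \<otimes>\<^bsub>M\<^esub> n') \<otimes>\<^bsub>M\<^esub> (m \<otimes>\<^bsub>M\<^esub> n))"
      using m n(1) n'(1) by (simp add: m_assoc)
    also have "\<dots> = n \<otimes>\<^bsub>M\<^esub> ((m \<otimes>\<^bsub>M\<^esub> n) \<otimes>\<^bsub>M\<^esub> (m \<otimes>\<^bsub>M\<^esub> n'))"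
      using E[OF id(1)[OF n'(1,2)] id(1)[OF n(1,2)]] by (rule arg_cong)
    also have "\<dots> = (n \<otimes>\<^bsub>M\<^esub> m \<otimes>\<^bsub>M\<^esub> n) \<otimes>\<^bsub>M\<^esub> m \<otimes>\<^bsub>M\<^esub> n'"
      using m n(1) n'(1) by (simp add: m_assoc)
    finally have 1: "n = n \<otimes>\<^bsub>M\<^esub> m \<otimes>\<^bsub>M\<^esub> n'" unfolding n(3) .
    have "n' = n' \<otimes>\<^bsub>M\<^esub> (m \<otimes>\<^bsub>M\<^esub> n \<otimes>\<^bsub>M\<^esub> m) \<otimes>\<^bsub>M\<^esub> n'" using n n' by simp
    also have "\<dots> = ((n' \<otimes>\<^bsub>M\<^esub> m) \<otimes>\<^bsub>M\<^esub> (n \<otimes>\<^bsub>M\<^esub> m)) \<otimes>\<^bsub>M\<^esub> n'"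
      using m n(1) n'(1) by (simp add: m_assoc)
    also have "\<dots> = ((n \<otimes>\<^bsub>M\<^esub> m) \<otimes>\<^bsub>M\<^esub> (n' \<otimes>\<^bsub>M\<^esub> m)) \<otimes>\<^bsub>M\<^esub> n'"
      using E[OF id(2)[OF n'(1,2)] id(2)[OF n(1,2)]] by (rule arg_cong)
    also have "\<dots> = n \<otimes>\<^bsub>M\<^esub> m \<otimes>\<^bsub>M\<^esub> (n' \<otimes>\<^bsub>M\<^esub> m \<otimes>\<^bsub>M\<^esub> n')"
      using m n(1) n'(1) by (simp add: m_assoc)
    finally have "n' = n \<otimes>\<^bsub>M\<^esub> m \<otimes>\<^bsub>M\<^esub> n'" unfolding n'(3) .
    then show ?thesis using 1 by simp
  qed
  show ?thesis
    unfolding inverse_monoid_def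
  proof (intro conjI ballI)
    fix m assume m: "m \<in> carrier M"
    show "\<exists>!n. n \<in> carrier M \<and> m \<otimes>\<^bsub>M\<^esub> n \<otimes>\<^bsub>M\<^esub> m = m \<and> n \<otimes>\<^bsub>M\<^esub> m \<otimes>\<^bsub>M\<^esub> n = n"
      by (rule ex1I[of _ "i m"]) (use i[OF m] uniq[OF m] in blast)+
  qed fact
qed

lemma regular_op_quot:
  assumes "monoid M" "congruence M \<rho>" "regular_op M i"
  shows "\<exists>j. regular_op (quot_monoid M \<rho>) j"
proof -
  interpret monoid M by fact
  define r where "r A = (SOME a. a \<in> carrier M \<and> A = \<rho> `` {a})" for A
  have r: "r A \<in> carrier M" "A = \<rho> `` {r A}" if "A \<in> carrier (quot_monoid M \<rho>)" for A
    using someI_ex[of "\<lambda>a. a \<in> carrier M \<and> A = \<rho> `` {a}"] that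
    unfolding quot_carrier r_def by blast+
  define j where "j A = \<rho> `` {i (r A)}" for A
  have i: "i m \<in> carrier M" "m \<otimes>\<^bsub>M\<^esub> i m \<otimes>\<^bsub>M\<^esub> m = m" "i m \<otimes>\<^bsub>M\<^esub> m \<otimes>\<^bsub>M\<^esub> i m = i m"
    if "m \<in> carrier M" for m
    using assms(3) that unfolding regular_op_def by metis+
  have c: "e \<otimes>\<^bsub>M\<^esub> f = f \<otimes>\<^bsub>M\<^esub> e"
    if "e \<in> {m \<otimes>\<^bsub>M\<^esub> i m, i m \<otimes>\<^bsub>M\<^esub> m}" "f \<in> {n \<otimes>\<^bsub>M\<^esub> i n, i n \<otimes>\<^bsub>M\<^esub> n}"
       "m \<in> carrier M" "n \<in> carrier M" for e f m n
    using assms(3) that unfolding regular_op_def by blast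
  have j: "j A \<in> carrier (quot_monoid M \<rho>)" if "A \<in> carrier (quot_monoid M \<rho>)" for A
    using r(1)[OF that] i(1) unfolding quot_carrier j_def by blast
  have p: "A \<otimes>\<^bsub>quot_monoid M \<rho>\<^esub> j A = \<rho> `` {r A \<otimes>\<^bsub>M\<^esub> i (r A)}"
          "j A \<otimes>\<^bsub>quot_monoid M \<rho>\<^esub> A = \<rho> `` {i (r A) \<otimes>\<^bsub>M\<^esub> r A}"
    if "A \<in> carrier (quot_monoid M \<rho>)" for A
    using quot_mult[OF assms(1,2)] r[OF that] i(1) unfolding j_def by metis+
  have "regular_op (quot_monoid M \<rho>) j"
    unfolding regular_op_def
  proof (intro conjI ballI)
    fix A assume A: "A \<in> carrier (quot_monoid M \<rho>)"
    show "j A \<in> carrier (quot_monoid M \<rho>)" using j[OF A] .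
    show "A \<otimes>\<^bsub>quot_monoid M \<rho>\<^esub> j A \<otimes>\<^bsub>quot_monoid M \<rho>\<^esub> A = A"
      unfolding p[OF A] using quot_mult[OF assms(1,2)] r[OF A] i by (metis m_closed)
    show "j A \<otimes>\<^bsub>quot_monoid M \<rho>\<^esub> A \<otimes>\<^bsub>quot_monoid M \<rho>\<^esub> j A = j A"
      unfolding p[OF A] using quot_mult[OF assms(1,2)] r[OF A] i unfolding j_def by (metis m_closed)
  next
    fix e f
    assume "e \<in> (\<Union>m\<in>carrier (quot_monoid M \<rho>).
              {m \<otimes>\<^bsub>quot_monoid M \<rho>\<^esub> j m, j m \<otimes>\<^bsub>quot_monoid M \<rho>\<^esub> m})"
       and "f \<in> (\<Union>m\<in>carrier (quot_monoid M \<rho>).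
              {m \<otimes>\<^bsub>quot_monoid M \<rho>\<^esub> j m, j m \<otimes>\<^bsub>quot_monoid M \<rho>\<^esub> m})"
    then obtain A B x y where A: "A \<in> carrier (quot_monoid M \<rho>)" and B: "B \<in> carrier (quot_monoid M \<rho>)"
      and x: "x \<in> {r A \<otimes>\<^bsub>M\<^esub> i (r A), i (r A) \<otimes>\<^bsub>M\<^esub> r A}" "e = \<rho> `` {x}"
      and y: "y \<in> {r B \<otimes>\<^bsub>M\<^esub> i (r B), i (r B) \<otimes>\<^bsub>M\<^esub> r B}" "f = \<rho> `` {y}"
      using p by blast
    have "x \<in> carrier M" "y \<in> carrier M" using x(1) y(1) r(1)[OF A] r(1)[OF B] i(1) by auto
    then show "e \<otimes>\<^bsub>quot_monoid M \<rho>\<^esub> f = f \<otimes>\<^bsub>quot_monoid M \<rho>\<^esub> e"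
      using c[OF x(1) y(1) r(1)[OF A] r(1)[OF B]] quot_mult[OF assms(1,2)] x(2) y(2) by metis
  qed
  then show ?thesis by (rule exI[of _ j])
qed

lemma monoid_word_monoid: "monoid (word_monoid X)"
  by (rule monoidI) (auto simp: word_monoid_def words_def)

lemma word_inv_word_inv [simp]: "word_inv (word_inv w) = w"
  by (simp add: word_inv_def rev_map comp_def case_prod_beta)

lemma word_inv_words [simp]: "word_inv w \<in> words X \<longleftrightarrow> w \<in> words X"
  by (force simp: word_inv_def words_def in_lists_conv_set)

lemma vagner_congruence: "congruence (word_monoid X) (vagner_cong X)"
  unfolding vagner_cong_def by (rule gen_cong_congruence[OF monoid_word_monoid])

lemma monoid_free_inverse_monoid: "monoid (free_inverse_monoid X)"
  unfolding free_inverse_monoid_def by (rule monoid_quot[OF monoid_word_monoid vagner_congruence])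

lemma relator_congruence: "congruence (free_inverse_monoid X) (relator_cong X R)"
  unfolding relator_cong_def by (rule gen_cong_congruence[OF monoid_free_inverse_monoid])

lemma append_words [simp]: "u @ v \<in> words X \<longleftrightarrow> u \<in> words X \<and> v \<in> words X"
  by (auto simp: words_def)

lemma fim_mult:
  assumes "u \<in> words X" "v \<in> words X"
  shows "fim_elem X u \<otimes>\<^bsub>free_inverse_monoid X\<^esub> fim_elem X v = fim_elem X (u @ v)"
  using quot_mult[OF monoid_word_monoid vagner_congruence, of u X v] assms
  by (simp add: fim_elem_def free_inverse_monoid_def word_monoid_def)

lemma fim_carrier: "A \<in> carrier (free_inverse_monoid X) \<longleftrightarrow> (\<exists>w \<in> words X. A = fim_elem X w)"
  unfolding free_inverse_monoid_def quot_carrier by (simp add: word_monoid_def fim_elem_def)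

lemma fim_eqI:
  assumes "(u, v) \<in> vagner_cong X"
  shows "fim_elem X u = fim_elem X v"
  using vagner_congruence assms unfolding fim_elem_def congruence_def by (metis equiv_class_eq)

lemma regular_op_fim: "\<exists>i. regular_op (free_inverse_monoid X) i"
proof -
  define r where "r A = (SOME w. w \<in> words X \<and> A = fim_elem X w)" for A
  have r: "r A \<in> words X" "A = fim_elem X (r A)" if "A \<in> carrier (free_inverse_monoid X)" for A
    using someI_ex[of "\<lambda>w. w \<in> words X \<and> A = fim_elem X w"] that
    unfolding fim_carrier r_def by blast+
  define j where "j A = fim_elem X (word_inv (r A))" for A
  have v1: "fim_elem X (w @ word_inv w @ w) = fim_elem X w" if "w \<in> words X" for w
    by (rule fim_eqI, unfold vagner_cong_def, rule gen_cong.base)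
       (use that in \<open>auto simp: word_monoid_def\<close>)
  have v2: "fim_elem X (u @ word_inv u @ w @ word_inv w) = fim_elem X (w @ word_inv w @ u @ word_inv u)"
    if "u \<in> words X" "w \<in> words X" for u w
    by (rule fim_eqI, unfold vagner_cong_def, rule gen_cong.base)
       (use that in \<open>auto simp: word_monoid_def\<close>)
  have p: "A \<otimes>\<^bsub>free_inverse_monoid X\<^esub> j A = fim_elem X (r A @ word_inv (r A))"
          "j A \<otimes>\<^bsub>free_inverse_monoid X\<^esub> A = fim_elem X (word_inv (r A) @ r A)"
    if "A \<in> carrier (free_inverse_monoid X)" for A
    using fim_mult[of "r A" X "word_inv (r A)"] fim_mult[of "word_inv (r A)" X "r A"]
      r(1)[OF that] r(2)[OF that, symmetric]
    by (simp_all add: j_def)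
  have "regular_op (free_inverse_monoid X) j"
    unfolding regular_op_def
  proof (intro conjI ballI)
    fix A assume A: "A \<in> carrier (free_inverse_monoid X)"
    show "j A \<in> carrier (free_inverse_monoid X)"
      unfolding fim_carrier j_def
      by (rule bexI[of _ "word_inv (r A)"]) (simp_all add: r(1)[OF A])
    have "fim_elem X (r A @ word_inv (r A)) \<otimes>\<^bsub>free_inverse_monoid X\<^esub> fim_elem X (r A) = fim_elem X (r A)"
      using v1 r(1)[OF A] by (simp add: fim_mult)
    then show "A \<otimes>\<^bsub>free_inverse_monoid X\<^esub> j A \<otimes>\<^bsub>free_inverse_monoid X\<^esub> A = A"
      unfolding p[OF A] r(2)[OF A, symmetric] .
    show "j A \<otimes>\<^bsub>free_inverse_monoid X\<^esub> A \<otimes>\<^bsub>free_inverse_monoid X\<^esub> j A = j A"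
      unfolding p[OF A] unfolding j_def
      using v1[of "word_inv (r A)"] r(1)[OF A] by (simp add: fim_mult)
  next
    fix e f
    assume e: "e \<in> (\<Union>m\<in>carrier (free_inverse_monoid X).
              {m \<otimes>\<^bsub>free_inverse_monoid X\<^esub> j m, j m \<otimes>\<^bsub>free_inverse_monoid X\<^esub> m})"
       and f: "f \<in> (\<Union>m\<in>carrier (free_inverse_monoid X).
              {m \<otimes>\<^bsub>free_inverse_monoid X\<^esub> j m, j m \<otimes>\<^bsub>free_inverse_monoid X\<^esub> m})"
    have *: "\<exists>u \<in> words X. g = fim_elem X (u @ word_inv u)"
      if g: "g \<in> (\<Union>m\<in>carrier (free_inverse_monoid X).
              {m \<otimes>\<^bsub>free_inverse_monoid X\<^esub> j m, j m \<otimes>\<^bsub>free_inverse_monoid X\<^esub> m})" for g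
    proof -
      from g obtain A where A: "A \<in> carrier (free_inverse_monoid X)"
        "g = A \<otimes>\<^bsub>free_inverse_monoid X\<^esub> j A \<or> g = j A \<otimes>\<^bsub>free_inverse_monoid X\<^esub> A"
        by blast
      show ?thesis
        using A(2) unfolding p[OF A(1)]
      proof
        assume "g = fim_elem X (r A @ word_inv (r A))"
        then show ?thesis using r(1)[OF A(1)] by (rule bexI)
      next
        assume "g = fim_elem X (word_inv (r A) @ r A)"
        then show ?thesis
          by (intro bexI[of _ "word_inv (r A)"]) (simp_all add: r(1)[OF A(1)])
      qed
    qed
    obtain u w where "u \<in> words X" "e = fim_elem X (u @ word_inv u)"
      and "w \<in> words X" "f = fim_elem X (w @ word_inv w)"
      using *[OF e] *[OF f] by (elim bexE)
    then show "e \<otimes>\<^bsub>free_inverse_monoid X\<^esub> f = f \<otimes>\<^bsub>free_inverse_monoid X\<^esub> e"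
      using v2 by (simp add: fim_mult)
  qed
  then show ?thesis by (rule exI[of _ j])
qed

theorem inverse_monoid_free_inverse_monoid: "inverse_monoid (free_inverse_monoid X)"
proof -
  obtain i where "regular_op (free_inverse_monoid X) i"
    using regular_op_fim by (rule exE)
  then show ?thesis by (rule regular_op_inverse_monoid[OF monoid_free_inverse_monoid])
qed

theorem inverse_monoid_presented_monoid: "inverse_monoid (presented_monoid X R)"
proof -
  obtain i where "regular_op (free_inverse_monoid X) i"
    using regular_op_fim by (rule exE)
  from regular_op_quot[OF monoid_free_inverse_monoid relator_congruence this]
  obtain j where "regular_op (presented_monoid X R) j"
    unfolding presented_monoid_def by (rule exE)
  moreover have "monoid (presented_monoid X R)"
    unfolding presented_monoid_def
    by (rule monoid_quot[OF monoid_free_inverse_monoid relator_congruence])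
  ultimately show ?thesis by (intro regular_op_inverse_monoid)
qed

text \<open>The \<open>\<H>\<close>-class of the identity is HOL-Algebra's group of units.\<close>

lemma maximal_subgroup_one:
  assumes "monoid M"
  shows "maximal_subgroup M \<one>\<^bsub>M\<^esub> = units_of M"
proof -
  interpret monoid M by fact
  have R: "green_R M \<one>\<^bsub>M\<^esub> b \<longleftrightarrow> b \<in> carrier M \<and> (\<exists>x \<in> carrier M. b \<otimes>\<^bsub>M\<^esub> x = \<one>\<^bsub>M\<^esub>)" for b
  proof
    assume "green_R M \<one>\<^bsub>M\<^esub> b"
    then show "b \<in> carrier M \<and> (\<exists>x \<in> carrier M. b \<otimes>\<^bsub>M\<^esub> x = \<one>\<^bsub>M\<^esub>)"
      unfolding green_R_def by (metis imageE image_eqI one_closed l_one)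
  next
    assume "b \<in> carrier M \<and> (\<exists>x \<in> carrier M. b \<otimes>\<^bsub>M\<^esub> x = \<one>\<^bsub>M\<^esub>)"
    then obtain x where x: "b \<in> carrier M" "x \<in> carrier M" "b \<otimes>\<^bsub>M\<^esub> x = \<one>\<^bsub>M\<^esub>" by blast
    have "y \<in> (\<lambda>x. b \<otimes>\<^bsub>M\<^esub> x) ` carrier M" if "y \<in> carrier M" for y
      using x that by (intro image_eqI[of _ _ "x \<otimes>\<^bsub>M\<^esub> y"]) (auto simp: m_assoc[symmetric])
    then show "green_R M \<one>\<^bsub>M\<^esub> b" using x(1) by (auto simp: green_R_def)
  qed
  have L: "green_L M \<one>\<^bsub>M\<^esub> b \<longleftrightarrow> b \<in> carrier M \<and> (\<exists>x \<in> carrier M. x \<otimes>\<^bsub>M\<^esub> b = \<one>\<^bsub>M\<^esub>)" for b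
  proof
    assume "green_L M \<one>\<^bsub>M\<^esub> b"
    then show "b \<in> carrier M \<and> (\<exists>x \<in> carrier M. x \<otimes>\<^bsub>M\<^esub> b = \<one>\<^bsub>M\<^esub>)"
      unfolding green_L_def by (metis imageE image_eqI one_closed r_one)
  next
    assume "b \<in> carrier M \<and> (\<exists>x \<in> carrier M. x \<otimes>\<^bsub>M\<^esub> b = \<one>\<^bsub>M\<^esub>)"
    then obtain x where x: "b \<in> carrier M" "x \<in> carrier M" "x \<otimes>\<^bsub>M\<^esub> b = \<one>\<^bsub>M\<^esub>" by blast
    have "y \<in> (\<lambda>x. x \<otimes>\<^bsub>M\<^esub> b) ` carrier M" if "y \<in> carrier M" for y
      using x that by (intro image_eqI[of _ _ "y \<otimes>\<^bsub>M\<^esub> x"]) (auto simp: m_assoc)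
    then show "green_L M \<one>\<^bsub>M\<^esub> b" using x(1) by (auto simp: green_L_def)
  qed
  have "H_class M \<one>\<^bsub>M\<^esub> = Units M"
  proof (intro Set.set_eqI iffI)
    fix b assume "b \<in> H_class M \<one>\<^bsub>M\<^esub>"
    then obtain x y where xy: "b \<in> carrier M" "x \<in> carrier M" "b \<otimes>\<^bsub>M\<^esub> x = \<one>\<^bsub>M\<^esub>"
      "y \<in> carrier M" "y \<otimes>\<^bsub>M\<^esub> b = \<one>\<^bsub>M\<^esub>"
      unfolding H_class_def R L by blast
    have "y = x" by (rule inv_unique[OF xy(5) xy(3) xy(1) xy(4) xy(2)])
    then show "b \<in> Units M" using xy unfolding Units_def by blast
  next
    fix b assume "b \<in> Units M"
    then show "b \<in> H_class M \<one>\<^bsub>M\<^esub>" unfolding H_class_def R L Units_def by blast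
  qed
  then show ?thesis by (simp add: maximal_subgroup_def units_of_def)
qed

end

theory Submission
  imports Defs
begin

text \<open>
  The idea is to find an idempotent whose Schuetzenberger graph has automorphism group \<open>Q\<close>. The
  elements of \<open>Q\<close> act by automorphisms on the Schuetzenberger graph \<open>\<Gamma>\<close> of \<open>1\<close>, whose vertices are
  the right units. Let \<open>e\<close> be the product of the idempotents \<open>q v v\<inverse> q\<inverse>\<close> over all \<open>q \<in> Q\<close>; it is
  an element of \<open>M\<close> because \<open>Q\<close> is finite, and conjugation by \<open>Q\<close> permutes the factors, so \<open>e\<close>
  commutes with \<open>Q\<close> and \<open>q \<mapsto> eq\<close> is a homomorphism from \<open>Q\<close> to the maximal subgroup at \<open>e\<close>
  (\<open>bridge_meet\<close>).

  The Schuetzenberger graph of \<open>e\<close> arises from \<open>\<Gamma>\<close> by attaching at each vertex \<open>q \<in> Q\<close> a new edge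
  labelled \<open>v\<close>, a bridge, that leads to the root of a fresh copy of \<open>\<Gamma>\<close>. Since \<open>v\<close> is neither a
  right nor a left unit, no edge labelled \<open>v\<close> leaves a vertex of \<open>Q\<close> in \<open>\<Gamma>\<close>, and none enters the
  root. Hence nothing has to be folded: the generators act on the vertices by partial bijections
  (\<open>partial_bijections\<close>). Relators label loops at all vertices, so words equal in \<open>M\<close> act equally
  (\<open>path_cong\<close>, from the universal property \<open>presented_elem_eq_imp\<close>). In the other direction,
  elements of \<open>eM\<close> that lead from the root to the same vertex are equal (\<open>act_absorb\<close>).

  Consequently \<open>q \<mapsto> eq\<close> is injective, as \<open>eq\<close> leads from the root to \<open>q\<close> in the central copy. For
  surjectivity consider an element \<open>h\<close> of the maximal subgroup as an automorphism. Right units lead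
  from any vertex to a vertex in the same copy, so automorphisms permute the copies and therefore
  the bridges. Thus \<open>h\<close> maps the root, a vertex from which a bridge departs, to another such vertex,
  that is, to some \<open>q \<in> Q\<close> in the central copy, and \<open>h = eq\<close> (\<open>maximal_subgroup_element\<close>).
\<close>

section \<open>Inverse monoids\<close>

locale inv_mon = monoid G for G (structure) +
  assumes inverse: "inverse_monoid G"
begin

lemma sinv:
  assumes "m \<in> carrier G"
  shows sinv_closed: "sinv G m \<in> carrier G"
    and mult_sinv_mult: "m \<otimes> sinv G m \<otimes> m = m"
    and sinv_mult_sinv: "sinv G m \<otimes> m \<otimes> sinv G m = sinv G m"
proof -
  have "\<exists>!n. n \<in> carrier G \<and> m \<otimes> n \<otimes> m = m \<and> n \<otimes> m \<otimes> n = n"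
    using inverse assms unfolding inverse_monoid_def by blast
  from theI'[OF this]
  show "sinv G m \<in> carrier G" "m \<otimes> sinv G m \<otimes> m = m" "sinv G m \<otimes> m \<otimes> sinv G m = sinv G m"
    unfolding sinv_def by blast+
qed

lemma sinv_unique:
  assumes "m \<in> carrier G" "n \<in> carrier G" "m \<otimes> n \<otimes> m = m" "n \<otimes> m \<otimes> n = n"
  shows "sinv G m = n"
proof -
  have "\<exists>!n. n \<in> carrier G \<and> m \<otimes> n \<otimes> m = m \<and> n \<otimes> m \<otimes> n = n"
    using inverse assms(1) unfolding inverse_monoid_def by blast
  then show ?thesis using assms(2-4) sinv[OF assms(1)] by blast
qed

lemma sinv_sinv: "m \<in> carrier G \<Longrightarrow> sinv G (sinv G m) = m"
  by (rule sinv_unique) (simp_all add: sinv)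

text \<open>If \<open>x\<close> is the inverse of \<open>ef\<close>, then \<open>fxe\<close> is an inverse of \<open>ef\<close> as well, and it is
  idempotent. Hence \<open>x\<close> is idempotent, so it is its own inverse and equals \<open>ef\<close>.\<close>

lemma idem_mult_idem:
  assumes e: "e \<in> carrier G" "e \<otimes> e = e" and f: "f \<in> carrier G" "f \<otimes> f = f"
  shows "(e \<otimes> f) \<otimes> (e \<otimes> f) = e \<otimes> f"
proof -
  define x where "x = sinv G (e \<otimes> f)"
  have x: "x \<in> carrier G" "e \<otimes> f \<otimes> x \<otimes> (e \<otimes> f) = e \<otimes> f" "x \<otimes> (e \<otimes> f) \<otimes> x = x"
    using sinv[of "e \<otimes> f"] e f by (simp_all add: x_def)
  have ee: "e \<otimes> (e \<otimes> y) = e \<otimes> y" and ff: "f \<otimes> (f \<otimes> y) = f \<otimes> y" if "y \<in> carrier G" for y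
    using m_assoc[of e e y] m_assoc[of f f y] e f that by simp_all
  have xx: "x \<otimes> (e \<otimes> (f \<otimes> (x \<otimes> y))) = x \<otimes> y" if "y \<in> carrier G" for y
    using arg_cong[OF x(3), of "\<lambda>z. z \<otimes> y"] that e f x(1) by (simp add: m_assoc)
  have "sinv G (e \<otimes> f) = f \<otimes> x \<otimes> e"
    by (rule sinv_unique) (use x(1,2) e f ee ff xx in \<open>simp_all add: m_assoc\<close>)
  then have xfe: "x = f \<otimes> x \<otimes> e" unfolding x_def .
  have "x \<otimes> x = (f \<otimes> x \<otimes> e) \<otimes> (f \<otimes> x \<otimes> e)" using xfe by simp
  also have "\<dots> = f \<otimes> x \<otimes> e" using x(1) e f xx by (simp add: m_assoc)
  finally have idem: "x \<otimes> x = x" using xfe by simp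
  have "sinv G x = x" by (rule sinv_unique) (simp_all add: x(1) idem)
  moreover have "sinv G x = e \<otimes> f" by (rule sinv_unique) (use x e f in simp_all)
  ultimately show ?thesis using idem by simp
qed

text \<open>Both \<open>ef\<close> and \<open>fe\<close> are inverses of \<open>ef\<close>.\<close>

lemma idem_commute:
  assumes e: "e \<in> carrier G" "e \<otimes> e = e" and f: "f \<in> carrier G" "f \<otimes> f = f"
  shows "e \<otimes> f = f \<otimes> e"
proof -
  have ee: "e \<otimes> (e \<otimes> y) = e \<otimes> y" and ff: "f \<otimes> (f \<otimes> y) = f \<otimes> y" if "y \<in> carrier G" for y
    using m_assoc[of e e y] m_assoc[of f f y] e f that by simp_all
  note ef = idem_mult_idem[OF e f] and fe = idem_mult_idem[OF f e]
  have "sinv G (e \<otimes> f) = e \<otimes> f" by (rule sinv_unique) (use e f ef in simp_all)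
  moreover have "sinv G (e \<otimes> f) = f \<otimes> e"
    by (rule sinv_unique) (use e f ef fe ee ff in \<open>simp_all add: m_assoc\<close>)
  ultimately show ?thesis by simp
qed

lemma mult_sinv_idem:
  assumes "m \<in> carrier G"
  shows "(m \<otimes> sinv G m) \<otimes> (m \<otimes> sinv G m) = m \<otimes> sinv G m"
    and "(sinv G m \<otimes> m) \<otimes> (sinv G m \<otimes> m) = sinv G m \<otimes> m"
proof -
  note c = sinv_closed[OF assms] assms
  have "(m \<otimes> sinv G m) \<otimes> (m \<otimes> sinv G m) = (m \<otimes> sinv G m \<otimes> m) \<otimes> sinv G m"
    using c by (simp add: m_assoc)
  then show "(m \<otimes> sinv G m) \<otimes> (m \<otimes> sinv G m) = m \<otimes> sinv G m"
    by (simp add: mult_sinv_mult assms)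
  have "(sinv G m \<otimes> m) \<otimes> (sinv G m \<otimes> m) = (sinv G m \<otimes> m \<otimes> sinv G m) \<otimes> m"
    using c by (simp add: m_assoc)
  then show "(sinv G m \<otimes> m) \<otimes> (sinv G m \<otimes> m) = sinv G m \<otimes> m"
    by (simp add: sinv_mult_sinv assms)
qed

text \<open>Right multiplication by \<open>m\<close> is injective where it stays among the right invertible
  elements: \<open>sm\<close> right invertible already forces \<open>s m m\<inverse> = s\<close>.\<close>

lemma right_invertible_mult_sinv:
  assumes s: "s \<in> carrier G" "t \<in> carrier G" "s \<otimes> t = \<one>"
    and m: "m \<in> carrier G" "u \<in> carrier G" "s \<otimes> m \<otimes> u = \<one>"
  shows "s \<otimes> m \<otimes> sinv G m = s"
proof -
  define f where "f = m \<otimes> sinv G m"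
  define g where "g = sinv G s \<otimes> s"
  have c: "f \<in> carrier G" "g \<in> carrier G" "sinv G s \<in> carrier G" "sinv G m \<in> carrier G"
    using s m sinv_closed by (simp_all add: f_def g_def)
  have fg: "f \<otimes> g = g \<otimes> f"
    by (rule idem_commute) (use c mult_sinv_idem s m in \<open>simp_all add: f_def g_def\<close>)
  have fm: "f \<otimes> m = m" using mult_sinv_mult[OF m(1)] by (simp add: f_def)
  have sg: "s \<otimes> g = s"
    using mult_sinv_mult[OF s(1)] s(1) c by (simp add: g_def m_assoc)
  have "s \<otimes> f \<otimes> sinv G s = s \<otimes> f \<otimes> sinv G s \<otimes> (s \<otimes> m \<otimes> u)"
    using c s m by simp
  also have "\<dots> = s \<otimes> (f \<otimes> g) \<otimes> m \<otimes> u"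
    using c s m by (simp add: g_def m_assoc)
  also have "\<dots> = (s \<otimes> g) \<otimes> (f \<otimes> m) \<otimes> u"
    unfolding fg using c s(1) m(1,2) by (simp add: m_assoc)
  also have "\<dots> = \<one>" using sg fm m by simp
  finally have one: "s \<otimes> f \<otimes> sinv G s = \<one>" .
  have "s \<otimes> f = s \<otimes> g \<otimes> f" using sg by simp
  also have "\<dots> = s \<otimes> (f \<otimes> g)" using fg c s(1) by (simp add: m_assoc)
  also have "\<dots> = (s \<otimes> f \<otimes> sinv G s) \<otimes> s" using c s(1) by (simp add: g_def m_assoc)
  finally have "s \<otimes> f = s" using one s(1) by simp
  then show ?thesis using c s m by (simp add: f_def m_assoc)
qed

lemma right_unitI:
  assumes "s \<in> carrier G" "t \<in> carrier G" "s \<otimes> t = \<one>"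
  shows "right_unit G s"
proof -
  have "s \<otimes> sinv G s = s \<otimes> sinv G s \<otimes> (s \<otimes> t)" using assms sinv_closed by simp
  also have "\<dots> = s \<otimes> sinv G s \<otimes> s \<otimes> t" using assms(1,2) sinv_closed by (simp add: m_assoc)
  also have "\<dots> = \<one>" using assms by (simp add: mult_sinv_mult)
  finally show ?thesis using assms(1) by (simp add: right_unit_def)
qed

lemma left_unitI:
  assumes "s \<in> carrier G" "t \<in> carrier G" "t \<otimes> s = \<one>"
  shows "left_unit G s"
proof -
  have "sinv G s \<otimes> s = (t \<otimes> s) \<otimes> (sinv G s \<otimes> s)" using assms sinv_closed by simp
  also have "\<dots> = t \<otimes> (s \<otimes> sinv G s \<otimes> s)" using assms(1,2) sinv_closed by (simp add: m_assoc)
  also have "\<dots> = \<one>" using assms by (simp add: mult_sinv_mult)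
  finally show ?thesis using assms(1) by (simp add: left_unit_def)
qed

end

text \<open>The meet of finitely many idempotents is their product. The last conclusion is the induction
  principle over this product; it yields both that the meet is greatest among the lower bounds and
  that it fixes whatever all factors fix.\<close>

lemma (in inv_mon) finite_meet:
  assumes "finite F" "F \<subseteq> carrier G" "\<forall>f \<in> F. f \<otimes> f = f"
  shows "\<exists>e \<in> carrier G. e \<otimes> e = e \<and> (\<forall>f \<in> F. e \<otimes> f = e) \<and>
    (\<forall>P. P \<one> \<longrightarrow> (\<forall>x \<in> F. \<forall>y \<in> carrier G. P y \<longrightarrow> P (x \<otimes> y)) \<longrightarrow> P e)"
  using assms
proof (induction F)
  case empty
  then show ?case by (intro bexI[of _ \<one>]) simp_all
next
  case (insert f F)
  have "F \<subseteq> carrier G" "\<forall>f \<in> F. f \<otimes> f = f" using insert.prems by simp_all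
  from insert.IH[OF this] obtain e where e: "e \<in> carrier G" "e \<otimes> e = e" "\<forall>f \<in> F. e \<otimes> f = e"
    "\<forall>P. P \<one> \<longrightarrow> (\<forall>x \<in> F. \<forall>y \<in> carrier G. P y \<longrightarrow> P (x \<otimes> y)) \<longrightarrow> P e"
    by (elim bexE conjE)
  have f: "f \<in> carrier G" "f \<otimes> f = f" using insert.prems by auto
  have ef: "e \<otimes> f = f \<otimes> e" by (rule idem_commute[OF e(1,2) f])
  show ?case
  proof (intro bexI[of _ "f \<otimes> e"] conjI ballI allI impI)
    show "f \<otimes> e \<in> carrier G" using f e by simp
    show "f \<otimes> e \<otimes> (f \<otimes> e) = f \<otimes> e" by (rule idem_mult_idem[OF f e(1,2)])
    fix g assume g: "g \<in> insert f F"
    then have gc: "g \<in> carrier G" using insert.prems by auto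
    show "f \<otimes> e \<otimes> g = f \<otimes> e"
    proof (cases "g = f")
      case True
      have "f \<otimes> e \<otimes> f = f \<otimes> (f \<otimes> e)" using f e(1) ef by (simp add: m_assoc)
      then show ?thesis using True f e(1) by (simp flip: m_assoc)
    next
      case False
      then show ?thesis using g gc e f by (simp add: m_assoc)
    qed
  next
    fix P :: "'a \<Rightarrow> bool"
    assume P: "P \<one>" "\<forall>x\<in>insert f F. \<forall>y\<in>carrier G. P y \<longrightarrow> P (x \<otimes> y)"
    have "P e" by (rule e(4)[rule_format]) (use P in blast)+
    then show "P (f \<otimes> e)" using P e(1) by blast
  qed
qed

lemma (in monoid) H_class_idem_iff:
  assumes "e \<in> carrier G" "e \<otimes> e = e"
  shows "h \<in> H_class G e \<longleftrightarrow> h \<in> carrier G \<and> e \<otimes> h = h \<and> h \<otimes> e = h \<and>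
    (\<exists>x \<in> carrier G. h \<otimes> x = e) \<and> (\<exists>y \<in> carrier G. y \<otimes> h = e)"
proof
  assume "h \<in> H_class G e"
  then have R: "(\<lambda>x. e \<otimes> x) ` carrier G = (\<lambda>x. h \<otimes> x) ` carrier G"
    and L: "(\<lambda>x. x \<otimes> e) ` carrier G = (\<lambda>x. x \<otimes> h) ` carrier G" and h: "h \<in> carrier G"
    unfolding H_class_def green_R_def green_L_def by blast+
  have "h \<in> (\<lambda>x. e \<otimes> x) ` carrier G" unfolding R using h by (intro image_eqI[of _ _ \<one>]) simp_all
  then have eh: "e \<otimes> h = h" using assms by (auto simp flip: m_assoc)
  have "h \<in> (\<lambda>x. x \<otimes> e) ` carrier G" unfolding L using h by (intro image_eqI[of _ _ \<one>]) simp_all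
  then have he: "h \<otimes> e = h" using assms by (auto simp: m_assoc)
  have "e \<in> (\<lambda>x. h \<otimes> x) ` carrier G" unfolding R[symmetric] using assms(1)
    by (intro image_eqI[of _ _ \<one>]) simp_all
  moreover have "e \<in> (\<lambda>x. x \<otimes> h) ` carrier G" unfolding L[symmetric] using assms(1)
    by (intro image_eqI[of _ _ \<one>]) simp_all
  ultimately have "\<exists>x \<in> carrier G. h \<otimes> x = e" "\<exists>y \<in> carrier G. y \<otimes> h = e"
    by (metis imageE)+
  then show "h \<in> carrier G \<and> e \<otimes> h = h \<and> h \<otimes> e = h \<and>
    (\<exists>x \<in> carrier G. h \<otimes> x = e) \<and> (\<exists>y \<in> carrier G. y \<otimes> h = e)"
    using h eh he by (intro conjI)
next
  assume "h \<in> carrier G \<and> e \<otimes> h = h \<and> h \<otimes> e = h \<and>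
    (\<exists>x \<in> carrier G. h \<otimes> x = e) \<and> (\<exists>y \<in> carrier G. y \<otimes> h = e)"
  then obtain x y where h: "h \<in> carrier G" "e \<otimes> h = h" "h \<otimes> e = h"
    and x: "x \<in> carrier G" "h \<otimes> x = e" and y: "y \<in> carrier G" "y \<otimes> h = e" by blast
  have "(\<lambda>x. e \<otimes> x) ` carrier G = (\<lambda>x. h \<otimes> x) ` carrier G"
  proof (intro equalityI image_subsetI)
    fix z assume z: "z \<in> carrier G"
    have "e \<otimes> z = h \<otimes> (x \<otimes> z)" using x h(1) z by (simp flip: m_assoc)
    then show "e \<otimes> z \<in> (\<lambda>x. h \<otimes> x) ` carrier G" using x z by simp
    have "h \<otimes> z = e \<otimes> (h \<otimes> z)" using h assms(1) z by (simp flip: m_assoc)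
    then show "h \<otimes> z \<in> (\<lambda>x. e \<otimes> x) ` carrier G" using h z by simp
  qed
  moreover have "(\<lambda>x. x \<otimes> e) ` carrier G = (\<lambda>x. x \<otimes> h) ` carrier G"
  proof (intro equalityI image_subsetI)
    fix z assume z: "z \<in> carrier G"
    have "z \<otimes> e = (z \<otimes> y) \<otimes> h" using y h(1) z by (simp add: m_assoc)
    then show "z \<otimes> e \<in> (\<lambda>x. x \<otimes> h) ` carrier G" using y z by simp
    have "z \<otimes> h = (z \<otimes> h) \<otimes> e" using h assms(1) z by (simp add: m_assoc)
    then show "z \<otimes> h \<in> (\<lambda>x. x \<otimes> e) ` carrier G" using h z by simp
  qed
  ultimately show "h \<in> H_class G e" using h(1) assms(1)
    by (simp add: H_class_def green_R_def green_L_def)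
qed

section \<open>Evaluating words in a presented inverse monoid\<close>

lemma fim_elem_eq_iff:
  assumes "w \<in> words X"
  shows "fim_elem X u = fim_elem X w \<longleftrightarrow> (u, w) \<in> vagner_cong X"
proof
  assume eq: "fim_elem X u = fim_elem X w"
  have "equiv (words X) (vagner_cong X)"
    using vagner_congruence[of X] by (simp add: congruence_def word_monoid_def)
  then show "(u, w) \<in> vagner_cong X"
    using eq_equiv_class[OF eq[unfolded fim_elem_def]] assms by blast
qed (rule fim_eqI)

lemma presented_elem_eq_iff:
  assumes "w \<in> words X"
  shows "presented_elem X R u = presented_elem X R w \<longleftrightarrow>
    (fim_elem X u, fim_elem X w) \<in> relator_cong X R"
proof -
  have equiv: "equiv (carrier (free_inverse_monoid X)) (relator_cong X R)"
    using relator_congruence[of X R] by (simp add: congruence_def)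
  have "fim_elem X w \<in> carrier (free_inverse_monoid X)" using assms fim_carrier by blast
  then show ?thesis
    unfolding presented_elem_def using eq_equiv_class[OF _ equiv] equiv_class_eq[OF equiv] by blast
qed

lemma presented_elem_append:
  assumes "u \<in> words X" "w \<in> words X"
  shows "presented_elem X R (u @ w) =
    presented_elem X R u \<otimes>\<^bsub>presented_monoid X R\<^esub> presented_elem X R w"
proof -
  have "fim_elem X u \<in> carrier (free_inverse_monoid X)" "fim_elem X w \<in> carrier (free_inverse_monoid X)"
    using assms fim_carrier by blast+
  then show ?thesis
    unfolding presented_elem_def presented_monoid_def
    by (simp add: quot_mult[OF monoid_free_inverse_monoid relator_congruence] fim_mult assms)
qed

lemma carrier_presented_monoid:
  "m \<in> carrier (presented_monoid X R) \<longleftrightarrow> (\<exists>w \<in> words X. m = presented_elem X R w)"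
  unfolding presented_monoid_def quot_carrier presented_elem_def Bex_def fim_carrier
  by blast

lemma presented_elem_Nil: "presented_elem X R [] = \<one>\<^bsub>presented_monoid X R\<^esub>"
  by (simp add: presented_elem_def presented_monoid_def quot_monoid_def free_inverse_monoid_def
      fim_elem_def word_monoid_def)

lemma presented_elem_relation:
  assumes "(u, w) \<in> R" "u \<in> words X" "w \<in> words X"
  shows "presented_elem X R u = presented_elem X R w"
  unfolding presented_elem_eq_iff[OF assms(3)] relator_cong_def
  by (rule gen_cong.base) (use assms in \<open>auto simp: fim_carrier\<close>)

lemma inv_mon_presented_monoid: "inv_mon (presented_monoid X R)"
proof -
  have inverse: "inverse_monoid (presented_monoid X R)" by (rule inverse_monoid_presented_monoid)
  then have "monoid (presented_monoid X R)" unfolding inverse_monoid_def by (rule conjunct1)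
  then show ?thesis using inverse by (intro inv_mon.intro inv_mon_axioms.intro)
qed

lemma presented_elem_word_inv:
  assumes "w \<in> words X"
  shows "presented_elem X R (word_inv w) = sinv (presented_monoid X R) (presented_elem X R w)"
proof -
  interpret inv_mon "presented_monoid X R" by (rule inv_mon_presented_monoid)
  have *: "presented_elem X R (u @ word_inv u @ u) = presented_elem X R u" if "u \<in> words X" for u
  proof -
    have "(u @ word_inv u @ u, u) \<in> vagner_cong X"
      unfolding vagner_cong_def by (rule gen_cong.base) (use that in \<open>auto simp: word_monoid_def\<close>)
    then show ?thesis unfolding presented_elem_def by (simp add: fim_eqI)
  qed
  have "presented_elem X R u \<in> carrier (presented_monoid X R)" if "u \<in> words X" for u
    using that carrier_presented_monoid by blast
  then show ?thesis
    by (intro sinv_unique[symmetric])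
      (use assms *[of w] *[of "word_inv w"] in \<open>auto simp flip: presented_elem_append\<close>)
qed

text \<open>The universal property of the presentation, in the form needed for constructing
  representations: a function on words that respects concatenation and satisfies the Vagner and the
  defining relations is constant on words with equal value.\<close>

lemma presented_elem_eq_imp:
  fixes A :: "'a word \<Rightarrow> 'b" and mul :: "'b \<Rightarrow> 'b \<Rightarrow> 'b"
  assumes hom: "\<And>u w. A (u @ w) = mul (A u) (A w)"
    and regular: "\<And>w. A (w @ word_inv w @ w) = A w"
    and commute: "\<And>u w. A (u @ word_inv u @ w @ word_inv w) = A (w @ word_inv w @ u @ word_inv u)"
    and relation: "\<And>u w. (u, w) \<in> R \<Longrightarrow> A u = A w"
    and words_R: "\<And>u w. (u, w) \<in> R \<Longrightarrow> u \<in> words X \<and> w \<in> words X"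
    and uw: "u \<in> words X" "w \<in> words X" "presented_elem X R u = presented_elem X R w"
  shows "A u = A w"
proof -
  have vagner: "A u = A w" if "(u, w) \<in> vagner_cong X" for u w
    using that unfolding vagner_cong_def
  proof induction
    case (base a b)
    then show ?case using regular commute by auto
  qed (simp_all add: hom word_monoid_def)
  have fim: "A u = A w" if "fim_elem X u = fim_elem X w" "w \<in> words X" for u w
    using vagner that fim_elem_eq_iff by blast
  have rep: "\<exists>u \<in> words X. a = fim_elem X u" if "a \<in> carrier (free_inverse_monoid X)" for a
    using that fim_carrier by blast
  have "\<forall>u \<in> words X. \<forall>w \<in> words X. a = fim_elem X u \<longrightarrow> b = fim_elem X w \<longrightarrow> A u = A w"
    if "(a, b) \<in> relator_cong X R" for a b
    using that unfolding relator_cong_def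
  proof induction
    case (base a b)
    then obtain u' w' where uw': "(u', w') \<in> R" "a = fim_elem X u'" "b = fim_elem X w'" by blast
    have "u' \<in> words X" "w' \<in> words X" "A u' = A w'" using uw'(1) relation words_R by blast+
    then show ?case using uw'(2,3) fim by metis
  next
    case (refl a)
    then show ?case using fim by metis
  next
    case (sym a b)
    then show ?case by metis
  next
    case (trans a b c)
    have "b \<in> carrier (free_inverse_monoid X)"
      using gen_cong_carrier[OF monoid_free_inverse_monoid trans.hyps(1)] by blast
    then obtain z where "z \<in> words X" "b = fim_elem X z" using rep by blast
    then show ?case using trans.IH by metis
  next
    case (mult a b c d)
    from mult.hyps have "a \<in> carrier (free_inverse_monoid X)" "b \<in> carrier (free_inverse_monoid X)"
      "c \<in> carrier (free_inverse_monoid X)" "d \<in> carrier (free_inverse_monoid X)"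
      using gen_cong_carrier[OF monoid_free_inverse_monoid] by blast+
    then obtain a' b' c' d' where *: "a' \<in> words X" "a = fim_elem X a'" "b' \<in> words X" "b = fim_elem X b'"
      "c' \<in> words X" "c = fim_elem X c'" "d' \<in> words X" "d = fim_elem X d'"
      using rep by meson
    then have "A a' = A b'" "A c' = A d'" using mult.IH by blast+
    then have eq: "A (a' @ c') = A (b' @ d')" by (simp add: hom)
    show ?case
    proof (intro ballI impI)
      fix u w assume "u \<in> words X" "w \<in> words X"
        and "a \<otimes>\<^bsub>free_inverse_monoid X\<^esub> c = fim_elem X u"
        and "b \<otimes>\<^bsub>free_inverse_monoid X\<^esub> d = fim_elem X w"
      then have "fim_elem X (a' @ c') = fim_elem X u" "fim_elem X (b' @ d') = fim_elem X w"
        using * by (simp_all add: fim_mult)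
      then have "A (a' @ c') = A u" "A (b' @ d') = A w"
        using fim \<open>u \<in> words X\<close> \<open>w \<in> words X\<close> by blast+
      then show "A u = A w" using eq by simp
    qed
  qed
  then show ?thesis using uw presented_elem_eq_iff by blast
qed

section \<open>Words acting by partial bijections\<close>

definition letter_rel :: "('a \<Rightarrow> 'b rel) \<Rightarrow> 'a \<times> bool \<Rightarrow> 'b rel" where
  "letter_rel T l = (if snd l then T (fst l) else (T (fst l))\<inverse>)"

primrec word_rel :: "'b set \<Rightarrow> ('a \<Rightarrow> 'b rel) \<Rightarrow> 'a word \<Rightarrow> 'b rel" where
  "word_rel V T [] = Id_on V"
| "word_rel V T (l # w) = letter_rel T l O word_rel V T w"

locale partial_bijections =
  fixes V :: "'b set" and T :: "'a \<Rightarrow> 'b rel"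
  assumes edges: "T x \<subseteq> V \<times> V"
    and deterministic: "single_valued (T x)"
    and codeterministic: "single_valued ((T x)\<inverse>)"
begin

lemma letter_rel_subset: "letter_rel T l \<subseteq> V \<times> V"
  using edges by (auto simp: letter_rel_def)

lemma word_rel_subset: "word_rel V T w \<subseteq> V \<times> V"
  using letter_rel_subset by (induction w) (auto simp: relcomp_unfold)

lemma word_rel_append: "word_rel V T (u @ w) = word_rel V T u O word_rel V T w"
proof (induction u)
  case Nil
  show ?case using word_rel_subset[of w] by auto
qed (simp add: O_assoc)

lemma word_rel_single: "word_rel V T [l] = letter_rel T l"
  using letter_rel_subset[of l] by auto

lemma word_rel_word_inv: "word_rel V T (word_inv w) = (word_rel V T w)\<inverse>"
proof (induction w)
  case Nil
  show ?case by (auto simp: word_inv_def)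
next
  case (Cons l w)
  have "word_inv (l # w) = word_inv w @ [(fst l, \<not> snd l)]"
    by (simp add: word_inv_def split_beta)
  moreover have "letter_rel T (fst l, \<not> snd l) = (letter_rel T l)\<inverse>"
    by (auto simp: letter_rel_def)
  ultimately show ?case
    using Cons by (simp only: word_rel_append word_rel_single) (simp add: converse_relcomp)
qed

lemma single_valued_word_rel: "single_valued (word_rel V T w)"
proof (induction w)
  case (Cons l w)
  have "single_valued (letter_rel T l)"
    using deterministic codeterministic by (auto simp: letter_rel_def)
  then show ?case using Cons by (simp add: single_valued_relcomp)
qed (simp add: single_valued_Id_on)

lemma single_valued_converse_word_rel: "single_valued ((word_rel V T w)\<inverse>)"
  using single_valued_word_rel[of "word_inv w"] by (simp add: word_rel_word_inv)

lemma word_rel_word_inv_domain: "word_rel V T (w @ word_inv w) = Id_on (Domain (word_rel V T w))"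
proof -
  have "a = c" if "(a, b) \<in> word_rel V T w" "(c, b) \<in> word_rel V T w" for a b c
    using single_valued_converse_word_rel[of w] that by (auto dest: single_valuedD)
  then show ?thesis unfolding word_rel_append word_rel_word_inv by blast
qed

lemma word_rel_regular: "word_rel V T (w @ word_inv w @ w) = word_rel V T w"
proof -
  have "word_rel V T (w @ word_inv w @ w) = Id_on (Domain (word_rel V T w)) O word_rel V T w"
    unfolding word_rel_word_inv_domain[symmetric] by (simp add: word_rel_append O_assoc)
  then show ?thesis by auto
qed

lemma word_rel_idems_commute:
  "word_rel V T (u @ word_inv u @ w @ word_inv w) = word_rel V T (w @ word_inv w @ u @ word_inv u)"
proof -
  have "word_rel V T (u @ word_inv u @ w @ word_inv w) =
      Id_on (Domain (word_rel V T u)) O Id_on (Domain (word_rel V T w))" for u w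
    unfolding word_rel_word_inv_domain[symmetric] by (simp add: word_rel_append O_assoc)
  then show ?thesis by auto
qed

end

section \<open>Copies of the right units joined by bridges\<close>

locale bridged_copies = inv_mon M for M :: "'a word set set monoid" (structure) +
  fixes X :: "'a set" and R :: "('a word \<times> 'a word) set" and v :: 'a and Q :: "'a word set set set"
  assumes special: "special_presentation X R"
    and M_eq: "M = presented_monoid X R"
    and v: "v \<in> X"
    and v_not_left_unit: "\<not> left_unit M (presented_elem X R [(v, True)])"
    and v_not_right_unit: "\<not> right_unit M (presented_elem X R [(v, True)])"
    and subgroup_Q: "subgroup Q (units_of M)"
begin

abbreviation val :: "'a word \<Rightarrow> 'a word set set" where
  "val \<equiv> presented_elem X R"

abbreviation gen :: "'a \<Rightarrow> 'a word set set" where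
  "gen x \<equiv> val [(x, True)]"

lemma val_append: "u \<in> words X \<Longrightarrow> w \<in> words X \<Longrightarrow> val (u @ w) = val u \<otimes> val w"
  unfolding M_eq by (rule presented_elem_append)

lemma val_closed [simp]: "w \<in> words X \<Longrightarrow> val w \<in> carrier M"
  unfolding M_eq carrier_presented_monoid by blast

lemma val_surj: "m \<in> carrier M \<Longrightarrow> \<exists>w \<in> words X. val w = m"
  unfolding M_eq carrier_presented_monoid by blast

lemma val_Nil: "val [] = \<one>"
  unfolding M_eq by (rule presented_elem_Nil)

lemma single_word [simp]: "[l] \<in> words X \<longleftrightarrow> fst l \<in> X"
  by (cases l) (simp add: words_def)

lemma Cons_words: "l # w \<in> words X \<longleftrightarrow> fst l \<in> X \<and> w \<in> words X"
  by (cases l) (simp add: words_def)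

lemma val_Cons: "fst l \<in> X \<Longrightarrow> w \<in> words X \<Longrightarrow> val (l # w) = val [l] \<otimes> val w"
  using val_append[of "[l]" w] by simp

lemma val_False: "x \<in> X \<Longrightarrow> val [(x, False)] = sinv M (gen x)"
  using presented_elem_word_inv[of "[(x, True)]" X R] by (simp add: word_inv_def M_eq)

text \<open>The right units. Asking for an arbitrary right inverse is enough by \<open>right_unitI\<close>, and it makes
  closure under products and prefixes immediate.\<close>

definition S :: "'a word set set set" where
  "S = {s \<in> carrier M. \<exists>t \<in> carrier M. s \<otimes> t = \<one>}"

lemma S_carrier: "s \<in> S \<Longrightarrow> s \<in> carrier M"
  by (simp add: S_def)

lemma one_in_S: "\<one> \<in> S"
  unfolding S_def using one_closed by force

lemma S_prefix:
  assumes "s \<in> carrier M" "m \<in> carrier M" "s \<otimes> m \<in> S"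
  shows "s \<in> S"
proof -
  obtain t where "t \<in> carrier M" "s \<otimes> m \<otimes> t = \<one>" using assms(3) by (auto simp: S_def)
  then have "m \<otimes> t \<in> carrier M" "s \<otimes> (m \<otimes> t) = \<one>" using assms by (simp_all add: m_assoc)
  then show ?thesis using assms(1) unfolding S_def by blast
qed

lemma S_mult_closed:
  assumes "s \<in> S" "t \<in> S"
  shows "s \<otimes> t \<in> S"
proof -
  obtain s' t' where c: "s \<in> carrier M" "t \<in> carrier M" "s' \<in> carrier M" "t' \<in> carrier M"
    and eq: "s \<otimes> s' = \<one>" "t \<otimes> t' = \<one>"
    using assms by (auto simp: S_def)
  have "s \<otimes> t \<otimes> (t' \<otimes> s') = s \<otimes> (t \<otimes> t') \<otimes> s'" using c by (simp add: m_assoc)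
  also have "\<dots> = \<one>" using c eq by simp
  finally show ?thesis using c unfolding S_def by blast
qed

lemma S_mult_sinv:
  assumes "s \<in> S" "m \<in> carrier M" "s \<otimes> m \<in> S"
  shows "s \<otimes> m \<otimes> sinv M m = s"
  using assms right_invertible_mult_sinv unfolding S_def by blast

lemma Q_Units: "q \<in> Q \<Longrightarrow> q \<in> Units M"
  using subgroup.mem_carrier[OF subgroup_Q] by (simp add: units_of_carrier)

lemma Q_carrier: "q \<in> Q \<Longrightarrow> q \<in> carrier M"
  using Q_Units by blast

lemma Q_one: "\<one> \<in> Q"
  using subgroup.one_closed[OF subgroup_Q] by (simp add: units_of_one)

lemma Q_mult: "p \<in> Q \<Longrightarrow> q \<in> Q \<Longrightarrow> p \<otimes> q \<in> Q"
  using subgroup.m_closed[OF subgroup_Q] by (simp add: units_of_mult)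

lemma Q_inv: "q \<in> Q \<Longrightarrow> inv q \<in> Q"
  using subgroup.m_inv_closed[OF subgroup_Q] by (metis Q_Units units_of_inv)

lemma Q_S: "q \<in> Q \<Longrightarrow> q \<in> S"
  unfolding S_def using Q_Units Q_carrier Units_r_inv Units_inv_closed by blast

lemma Q_cancel:
  assumes "q \<in> Q" "m \<in> carrier M"
  shows "inv q \<otimes> (q \<otimes> m) = m" "q \<otimes> (inv q \<otimes> m) = m"
  using assms Q_Units[OF assms(1)] Q_carrier by (simp_all flip: m_assoc)

lemma Q_gen_notin_S:
  assumes "q \<in> Q"
  shows "q \<otimes> gen v \<notin> S"
proof
  assume "q \<otimes> gen v \<in> S"
  then obtain t where t: "t \<in> carrier M" "q \<otimes> gen v \<otimes> t = \<one>" by (auto simp: S_def)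
  have c: "q \<in> carrier M" "inv q \<in> carrier M" "gen v \<in> carrier M"
    using assms Q_carrier Q_inv v by auto
  have "gen v \<otimes> (t \<otimes> q) = inv q \<otimes> (q \<otimes> (gen v \<otimes> (t \<otimes> q)))"
    using Q_cancel(1)[OF assms] c t(1) by simp
  also have "\<dots> = inv q \<otimes> ((q \<otimes> gen v \<otimes> t) \<otimes> q)" using c t(1) by (simp add: m_assoc)
  also have "\<dots> = \<one>" using t(2) c Q_Units[OF assms] by simp
  finally show False using right_unitI[of "gen v" "t \<otimes> q"] c t(1) v_not_right_unit by simp
qed

lemma S_gen_neq_one: "s \<in> S \<Longrightarrow> s \<otimes> gen v \<noteq> \<one>"
  using left_unitI[of "gen v" s] S_carrier v_not_left_unit v by auto

text \<open>The vertices are those of the Schuetzenberger graph of the idempotent \<open>e\<close> found below: the copy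
  \<open>None\<close> of the Schuetzenberger graph of \<open>1\<close>, whose vertices are the right units, and one copy
  \<open>Some q\<close> for each \<open>q \<in> Q\<close>, whose root is the far end of a bridge labelled \<open>v\<close> that leaves the
  central copy at \<open>q\<close>.\<close>

definition copies :: "'a word set set option set" where
  "copies = insert None (Some ` Q)"

definition vertices :: "('a word set set option \<times> 'a word set set) set" where
  "vertices = copies \<times> S"

definition arcs :: "'a \<Rightarrow> ('a word set set option \<times> 'a word set set) rel" where
  "arcs x = {((i, s), (i, s \<otimes> gen x)) | i s. i \<in> copies \<and> s \<in> S \<and> s \<otimes> gen x \<in> S \<and> x \<in> X} \<union>
     {((None, q), (Some q, \<one>)) | q. q \<in> Q \<and> x = v}"

text \<open>This is where the hypothesis on \<open>v\<close> enters. A bridge could share its source with another arc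
  labelled \<open>v\<close> only if \<open>v\<close> were right invertible, and its target only if \<open>v\<close> were left
  invertible.\<close>

lemma partial_bijections: "partial_bijections vertices arcs"
proof
  fix x
  show "arcs x \<subseteq> vertices \<times> vertices"
    by (auto simp: arcs_def vertices_def copies_def Q_S one_in_S)
  show "single_valued (arcs x)"
    using Q_gen_notin_S by (auto simp: arcs_def single_valued_def)
  have "s = t" if "s \<in> S" "t \<in> S" "s \<otimes> gen x \<in> S" "s \<otimes> gen x = t \<otimes> gen x" "x \<in> X" for s t
    using S_mult_sinv[of s "gen x"] S_mult_sinv[of t "gen x"] that by simp
  then show "single_valued ((arcs x)\<inverse>)"
    using S_gen_neq_one by (auto simp: arcs_def single_valued_def)
qed

sublocale partial_bijections vertices arcs
  by (rule partial_bijections)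

abbreviation path :: "'a word \<Rightarrow> ('a word set set option \<times> 'a word set set) rel" where
  "path \<equiv> word_rel vertices arcs"

lemma path_in_copy:
  assumes "w \<in> words X" "i \<in> copies" "s \<in> S" "s \<otimes> val w \<in> S"
  shows "((i, s), (i, s \<otimes> val w)) \<in> path w"
  using assms
proof (induction w arbitrary: s)
  case Nil
  then show ?case using S_carrier by (auto simp: val_Nil vertices_def)
next
  case (Cons l w)
  obtain x d where l: "l = (x, d)" by (cases l)
  have x: "x \<in> X" and w: "w \<in> words X" using Cons.prems(1) by (simp_all add: Cons_words l)
  have c: "s \<in> carrier M" "val [l] \<in> carrier M" "val w \<in> carrier M"
    using Cons.prems w x by (simp_all add: S_carrier l)
  have eq: "s \<otimes> val (l # w) = s \<otimes> val [l] \<otimes> val w"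
    using x w c by (simp add: val_Cons l m_assoc)
  have S: "s \<otimes> val [l] \<in> S" by (rule S_prefix[of _ "val w"]) (use c Cons.prems eq in simp_all)
  have "((i, s), (i, s \<otimes> val [l])) \<in> letter_rel arcs l"
  proof (cases d)
    case True
    then show ?thesis using Cons.prems S x by (auto simp: l letter_rel_def arcs_def)
  next
    case False
    have "s \<otimes> val [l] \<otimes> sinv M (val [l]) = s" by (rule S_mult_sinv) (use Cons.prems c S in simp_all)
    then have "s \<otimes> val [l] \<otimes> gen x = s"
      using False x sinv_sinv[of "gen x"] by (simp add: l val_False)
    moreover have "((i, s \<otimes> val [l]), (i, s \<otimes> val [l] \<otimes> gen x)) \<in> arcs x" if "s \<otimes> val [l] \<otimes> gen x \<in> S"
      using that Cons.prems S x unfolding arcs_def by blast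
    ultimately have "((i, s \<otimes> val [l]), (i, s)) \<in> arcs x" using Cons.prems by simp
    then show ?thesis using False by (simp add: l letter_rel_def)
  qed
  moreover have "((i, s \<otimes> val [l]), (i, s \<otimes> val (l # w))) \<in> path w"
    unfolding eq by (rule Cons.IH) (use w S Cons.prems eq in simp_all)
  ultimately show ?case by auto
qed

text \<open>A relator has value \<open>1\<close>, hence labels a loop at every vertex. So the action of words is an
  action of \<open>M\<close>.\<close>

lemma path_cong:
  assumes "u \<in> words X" "w \<in> words X" "val u = val w"
  shows "path u = path w"
proof (rule presented_elem_eq_imp[where A = path and mul = "(O)" and R = R and X = X])
  fix u w assume uw: "(u, w) \<in> R"
  then show u: "u \<in> words X \<and> w \<in> words X"
    using special by (auto simp: special_presentation_def words_def)
  have w: "w = []" using uw special by (auto simp: special_presentation_def)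
  have one: "val u = \<one>" using presented_elem_relation[OF uw] u val_Nil by (simp add: w)
  have loop: "(a, a) \<in> path u" if "a \<in> vertices" for a
    using that path_in_copy[of u "fst a" "snd a"] u one S_carrier by (auto simp: vertices_def)
  have "path u = Id_on vertices"
  proof (intro equalityI subrelI)
    fix a b assume ab: "(a, b) \<in> path u"
    then have a: "a \<in> vertices" using word_rel_subset by blast
    have "b = a" by (rule single_valuedD[OF single_valued_word_rel ab loop[OF a]])
    then show "(a, b) \<in> Id_on vertices" using a by blast
  qed (use loop in auto)
  then show "path u = path w" by (simp add: w)
qed (fact assms word_rel_append word_rel_regular word_rel_idems_commute)+

definition act :: "'a word set set \<Rightarrow> ('a word set set option \<times> 'a word set set) rel" where
  "act m = path (SOME w. w \<in> words X \<and> val w = m)"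

lemma act_val:
  assumes "w \<in> words X"
  shows "act (val w) = path w"
proof -
  have "(SOME u. u \<in> words X \<and> val u = val w) \<in> words X \<and> val (SOME u. u \<in> words X \<and> val u = val w) = val w"
    by (rule someI[of _ w]) (use assms in simp)
  then show ?thesis unfolding act_def by (intro path_cong) (use assms in auto)
qed

lemma act_mult:
  assumes "m \<in> carrier M" "n \<in> carrier M"
  shows "act (m \<otimes> n) = act m O act n"
proof -
  obtain u w where "u \<in> words X" "w \<in> words X" "val u = m" "val w = n"
    using assms val_surj by blast
  then show ?thesis using act_val[of "u @ w"] act_val[of u] act_val[of w]
    by (auto simp: val_append word_rel_append)
qed

lemma act_vertices: "act m \<subseteq> vertices \<times> vertices"
  unfolding act_def by (rule word_rel_subset)

lemma act_unique: "(a, b) \<in> act m \<Longrightarrow> (a, c) \<in> act m \<Longrightarrow> b = c"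
  unfolding act_def using single_valued_word_rel by (rule single_valuedD)

lemma act_sinv: "m \<in> carrier M \<Longrightarrow> act (sinv M m) = (act m)\<inverse>"
  using val_surj[of m] act_val presented_elem_word_inv[of _ X R] word_rel_word_inv
  by (metis M_eq word_inv_words)

lemma act_gen: "x \<in> X \<Longrightarrow> act (gen x) = arcs x"
  by (simp only: act_val single_word fst_conv word_rel_single) (simp add: letter_rel_def)

lemma act_in_copy:
  assumes "m \<in> carrier M" "i \<in> copies" "s \<in> S" "s \<otimes> m \<in> S"
  shows "((i, s), (i, s \<otimes> m)) \<in> act m"
  using val_surj[OF assms(1)] act_val path_in_copy assms by metis

text \<open>The element \<open>entry i \<otimes> s\<close> leads from the root \<open>(None, \<one>)\<close> to the vertex \<open>(i, s)\<close>.\<close>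

fun entry :: "'a word set set option \<Rightarrow> 'a word set set" where
  "entry None = \<one>"
| "entry (Some q) = q \<otimes> gen v"

lemma entry_closed: "i \<in> copies \<Longrightarrow> entry i \<in> carrier M"
  using v by (auto simp: copies_def Q_carrier)

text \<open>An element \<open>e\<close> that absorbs the round trip along every bridge turns a path into an equation:
  two elements of \<open>eM\<close> that lead from the root to the same vertex are equal.\<close>

lemma act_absorb:
  assumes e: "e \<in> carrier M" "\<And>q. q \<in> Q \<Longrightarrow> e \<otimes> (q \<otimes> (gen v \<otimes> sinv M (gen v))) = e \<otimes> q"
    and m: "m \<in> carrier M" "((i, s), (j, t)) \<in> act m"
  shows "e \<otimes> (entry i \<otimes> (s \<otimes> m)) = e \<otimes> (entry j \<otimes> t)"
proof -
  have arc: "e \<otimes> (entry i \<otimes> (s \<otimes> gen x)) = e \<otimes> (entry j \<otimes> t) \<and>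
      e \<otimes> (entry j \<otimes> (t \<otimes> sinv M (gen x))) = e \<otimes> (entry i \<otimes> s)"
    if "x \<in> X" "((i, s), (j, t)) \<in> arcs x" for i s j t x
    using that(2) unfolding arcs_def
  proof (elim UnE)
    assume "((i, s), (j, t)) \<in> {((i, s), (i, s \<otimes> gen x)) | i s. i \<in> copies \<and> s \<in> S \<and> s \<otimes> gen x \<in> S \<and> x \<in> X}"
    then show ?thesis using S_mult_sinv[of s "gen x"] that(1) by auto
  next
    assume "((i, s), (j, t)) \<in> {((None, q), (Some q, \<one>)) | q. q \<in> Q \<and> x = v}"
    then show ?thesis using e Q_carrier v sinv_closed[of "gen v"] by (auto simp: m_assoc)
  qed
  have "e \<otimes> (entry i \<otimes> (s \<otimes> val w)) = e \<otimes> (entry j \<otimes> t)"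
    if "w \<in> words X" "((i, s), (j, t)) \<in> path w" for w i s
    using that
  proof (induction w arbitrary: i s)
    case Nil
    then show ?case using S_carrier by (auto simp: val_Nil vertices_def)
  next
    case (Cons l w)
    obtain x d where l: "l = (x, d)" by (cases l)
    have x: "x \<in> X" and w: "w \<in> words X" using Cons.prems(1) by (simp_all add: Cons_words l)
    obtain k r where kr: "((i, s), (k, r)) \<in> letter_rel arcs l" "((k, r), (j, t)) \<in> path w"
      using Cons.prems(2) by auto
    have "(i, s) \<in> vertices" "(k, r) \<in> vertices" using kr(1) letter_rel_subset by blast+
    then have c: "s \<in> carrier M" "entry i \<in> carrier M" "r \<in> carrier M" "entry k \<in> carrier M"
      using S_carrier entry_closed by (auto simp: vertices_def)
    have lw: "val [l] \<in> carrier M" "val w \<in> carrier M" using x w by (simp_all add: l)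
    have step: "e \<otimes> (entry i \<otimes> (s \<otimes> val [l])) = e \<otimes> (entry k \<otimes> r)"
      using kr(1) arc[OF x] x by (cases d) (auto simp: l letter_rel_def val_False)
    have "e \<otimes> (entry i \<otimes> (s \<otimes> val (l # w))) = e \<otimes> (entry i \<otimes> (s \<otimes> val [l])) \<otimes> val w"
      using x w c lw e(1) by (simp add: val_Cons l m_assoc)
    also have "\<dots> = e \<otimes> (entry k \<otimes> (r \<otimes> val w))"
      unfolding step using c lw e(1) by (simp add: m_assoc)
    also have "\<dots> = e \<otimes> (entry j \<otimes> t)" by (rule Cons.IH[OF w kr(2)])
    finally show ?case .
  qed
  then show ?thesis using val_surj[OF m(1)] act_val m(2) by metis
qed

section \<open>The idempotent and its maximal subgroup\<close>

abbreviation bridge_idem :: "'a word set set \<Rightarrow> 'a word set set" where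
  "bridge_idem q \<equiv> q \<otimes> (gen v \<otimes> (sinv M (gen v) \<otimes> inv q))"

lemma bridge_closed: "gen v \<in> carrier M" "sinv M (gen v) \<in> carrier M"
  using v sinv_closed by simp_all

lemma bridge_idem_closed: "q \<in> Q \<Longrightarrow> bridge_idem q \<in> carrier M"
  using bridge_closed Q_carrier Q_inv by simp

lemma bridge_idem_idem:
  assumes "q \<in> Q"
  shows "bridge_idem q \<otimes> bridge_idem q = bridge_idem q"
proof -
  have c: "q \<in> carrier M" "inv q \<in> carrier M" using assms Q_carrier Q_inv by auto
  have "gen v \<otimes> (sinv M (gen v) \<otimes> (gen v \<otimes> m)) = gen v \<otimes> m" if "m \<in> carrier M" for m
    using arg_cong[OF mult_sinv_mult[OF bridge_closed(1)], of "\<lambda>z. z \<otimes> m"] that bridge_closed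
    by (simp add: m_assoc)
  then show ?thesis using c bridge_closed assms Q_cancel by (simp add: m_assoc)
qed

lemma bridge_idem_mult:
  assumes "p \<in> Q" "q \<in> Q"
  shows "bridge_idem (p \<otimes> q) \<otimes> p = p \<otimes> bridge_idem q"
proof -
  have c: "p \<in> carrier M" "inv p \<in> carrier M" "q \<in> carrier M" "inv q \<in> carrier M"
    using assms Q_carrier Q_inv by auto
  have "(inv q \<otimes> inv p) \<otimes> (p \<otimes> q) = \<one>" "(p \<otimes> q) \<otimes> (inv q \<otimes> inv p) = \<one>"
    using c Q_cancel assms Q_Units by (simp_all add: m_assoc)
  then have "inv (p \<otimes> q) = inv q \<otimes> inv p"
    using c by (intro inv_unique'[symmetric]) simp_all
  then show ?thesis using c bridge_closed Q_Units[OF assms(1)] by (simp add: m_assoc)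
qed

text \<open>Reading \<open>bridge_idem q\<close> from the root means going to \<open>(None, q)\<close>, crossing the bridge there,
  and returning the same way.\<close>

lemma bridge_idem_loop:
  assumes "q \<in> Q"
  shows "((None, \<one>), (None, \<one>)) \<in> act (bridge_idem q)"
proof -
  have c: "q \<in> carrier M" "inv q \<in> carrier M" using assms Q_carrier Q_inv by auto
  have "((None, \<one>), (None, q)) \<in> act q"
    using act_in_copy[of q None \<one>] c one_in_S Q_S[OF assms] by (simp add: copies_def)
  moreover have "((None, q), (Some q, \<one>)) \<in> act (gen v)"
    using assms v by (simp add: act_gen arcs_def)
  moreover from this have "((Some q, \<one>), (None, q)) \<in> act (sinv M (gen v))"
    by (simp add: act_sinv bridge_closed)
  moreover have "((None, q), (None, \<one>)) \<in> act (inv q)"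
    using act_in_copy[of "inv q" None q] c one_in_S Q_S[OF assms] Q_Units[OF assms] by (simp add: copies_def)
  ultimately show ?thesis using c bridge_closed by (auto simp: act_mult)
qed

text \<open>The meet of the idempotents \<open>bridge_idem q\<close> exists because \<open>Q\<close> is finite; it commutes with
  \<open>Q\<close> because conjugation by \<open>Q\<close> permutes these idempotents.\<close>

lemma bridge_meet:
  assumes "finite Q"
  obtains e where "e \<in> carrier M" "e \<otimes> e = e" "\<And>q. q \<in> Q \<Longrightarrow> e \<otimes> bridge_idem q = e"
    "\<And>q. q \<in> Q \<Longrightarrow> q \<otimes> e = e \<otimes> q" "((None, \<one>), (None, \<one>)) \<in> act e"
proof -
  have "\<exists>e \<in> carrier M. e \<otimes> e = e \<and> (\<forall>f \<in> bridge_idem ` Q. e \<otimes> f = e) \<and>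
    (\<forall>P. P \<one> \<longrightarrow> (\<forall>x \<in> bridge_idem ` Q. \<forall>y \<in> carrier M. P y \<longrightarrow> P (x \<otimes> y)) \<longrightarrow> P e)"
    by (rule finite_meet) (use assms bridge_idem_closed bridge_idem_idem in auto)
  then obtain e where e: "e \<in> carrier M" "e \<otimes> e = e" and "\<forall>f \<in> bridge_idem ` Q. e \<otimes> f = e"
    and ind: "\<forall>P. P \<one> \<longrightarrow> (\<forall>x \<in> bridge_idem ` Q. \<forall>y \<in> carrier M. P y \<longrightarrow> P (x \<otimes> y)) \<longrightarrow> P e"
    by (elim bexE conjE)
  then have le: "e \<otimes> bridge_idem q = e" if "q \<in> Q" for q using that by blast
  have "((None, \<one>), (None, \<one>)) \<in> act \<one>"
    using act_in_copy[of \<one> None \<one>] one_in_S by (simp add: copies_def)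
  then have loop: "((None, \<one>), (None, \<one>)) \<in> act e"
  proof (rule ind[rule_format])
    fix x y assume "x \<in> bridge_idem ` Q" and y: "y \<in> carrier M" "((None, \<one>), (None, \<one>)) \<in> act y"
    then have "x \<in> carrier M" "((None, \<one>), (None, \<one>)) \<in> act x"
      using bridge_idem_loop bridge_idem_closed by blast+
    then show "((None, \<one>), (None, \<one>)) \<in> act (x \<otimes> y)" using y by (auto simp: act_mult)
  qed
  have below: "k \<otimes> e = k" if k: "k \<in> carrier M" "\<And>q. q \<in> Q \<Longrightarrow> k \<otimes> bridge_idem q = k" for k
  proof (rule ind[rule_format])
    fix x y assume "x \<in> bridge_idem ` Q" "y \<in> carrier M" "k \<otimes> y = k"
    moreover from this have "x \<in> carrier M" "k \<otimes> x = k" using bridge_idem_closed k(2) by auto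
    ultimately show "k \<otimes> (x \<otimes> y) = k" using k(1) by (simp flip: m_assoc)
  qed (use k in simp)
  have eqe: "e \<otimes> (q \<otimes> e) = e \<otimes> q" if q: "q \<in> Q" for q
  proof -
    have c: "q \<in> carrier M" "e \<in> carrier M" using q e Q_carrier by auto
    have "(e \<otimes> q) \<otimes> bridge_idem p = e \<otimes> q" if p: "p \<in> Q" for p
    proof -
      have "(e \<otimes> q) \<otimes> bridge_idem p = e \<otimes> (q \<otimes> bridge_idem p)"
        by (rule m_assoc[OF c(2,1) bridge_idem_closed[OF p]])
      also have "\<dots> = e \<otimes> (bridge_idem (q \<otimes> p) \<otimes> q)" by (simp only: bridge_idem_mult[OF q p])
      also have "\<dots> = (e \<otimes> bridge_idem (q \<otimes> p)) \<otimes> q"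
        by (rule m_assoc[symmetric, OF c(2) bridge_idem_closed[OF Q_mult[OF q p]] c(1)])
      also have "\<dots> = e \<otimes> q" by (simp only: le[OF Q_mult[OF q p]])
      finally show ?thesis .
    qed
    then have "(e \<otimes> q) \<otimes> e = e \<otimes> q" by (intro below) (use c in simp_all)
    then show ?thesis using c by (simp add: m_assoc)
  qed
  have "q \<otimes> e = e \<otimes> q" if q: "q \<in> Q" for q
  proof -
    define f where "f = q \<otimes> e \<otimes> inv q"
    have c: "q \<in> carrier M" "inv q \<in> carrier M" "e \<in> carrier M" using q e Q_carrier Q_inv by auto
    have ee: "e \<otimes> (e \<otimes> m) = e \<otimes> m" if "m \<in> carrier M" for m
      using that e by (simp flip: m_assoc)
    have fc: "f \<in> carrier M" using c by (simp add: f_def)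
    have ff: "f \<otimes> f = f" using c q Q_cancel(1) ee by (simp add: f_def m_assoc)
    have fq: "f \<otimes> q = q \<otimes> e" using c Q_Units[OF q] by (simp add: f_def m_assoc)
    have "f \<otimes> e = q \<otimes> (e \<otimes> (inv q \<otimes> e))" using c by (simp add: f_def m_assoc)
    also have "\<dots> = f" using eqe[OF Q_inv[OF q]] c by (simp add: f_def m_assoc)
    finally have "e \<otimes> f = f" using idem_commute[OF e fc ff] by simp
    then have "e \<otimes> f \<otimes> q = f \<otimes> q" by simp
    then have "e \<otimes> (q \<otimes> e) = q \<otimes> e" using fq c fc by (simp add: m_assoc)
    then show ?thesis using eqe[OF q] by simp
  qed
  then show thesis using that e le loop by blast
qed

text \<open>The automorphism of the graph that belongs to an element \<open>h\<close> of the maximal subgroup permutes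
  the copies. If \<open>h\<close> moved the root to a vertex where a \<open>v\<close>-arc stays inside its copy, then the
  inverse automorphism would carry this arc to the bridge from \<open>(None, \<one>)\<close> to \<open>(Some \<one>, \<one>)\<close>,
  although the ends of a bridge lie in different copies. So \<open>h\<close> moves the root to the source of a
  bridge.\<close>

lemma maximal_subgroup_element:
  assumes e: "e \<in> carrier M" "e \<otimes> e = e"
    and le: "\<And>q. q \<in> Q \<Longrightarrow> e \<otimes> bridge_idem q = e"
    and loop: "((None, \<one>), (None, \<one>)) \<in> act e"
    and h: "h \<in> H_class M e"
  shows "\<exists>q \<in> Q. h = e \<otimes> q"
proof -
  note bc = bridge_closed
  obtain x y where hc: "h \<in> carrier M" "e \<otimes> h = h" "h \<otimes> e = h"
    and x: "x \<in> carrier M" "h \<otimes> x = e" and y: "y \<in> carrier M" "y \<otimes> h = e"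
    using h unfolding H_class_idem_iff[OF e] by blast
  have absorb: "e \<otimes> (q \<otimes> (gen v \<otimes> sinv M (gen v))) = e \<otimes> q" if q: "q \<in> Q" for q
  proof -
    have c: "q \<in> carrier M" "inv q \<in> carrier M" using q Q_carrier Q_inv by auto
    have "e \<otimes> q = (e \<otimes> bridge_idem q) \<otimes> q" by (simp only: le[OF q])
    also have "\<dots> = e \<otimes> (q \<otimes> (gen v \<otimes> sinv M (gen v)))"
      using c bc e(1) Q_Units[OF q] by (simp add: m_assoc)
    finally show ?thesis by simp
  qed
  have "((None, \<one>), (None, \<one>)) \<in> act h O act x" using loop x hc(1) by (simp flip: act_mult)
  then obtain i s where root: "((None, \<one>), (i, s)) \<in> act h" by auto
  then have "(i, s) \<in> vertices" using act_vertices by blast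
  then have i: "i \<in> copies" and s: "s \<in> S" "s \<in> carrier M" using S_carrier by (auto simp: vertices_def)
  have ic: "entry i \<in> carrier M" by (rule entry_closed[OF i])
  have h_eq: "h = e \<otimes> (entry i \<otimes> s)"
    using act_absorb[OF e(1) absorb hc(1) root] hc by simp
  have "h \<otimes> (gen v \<otimes> sinv M (gen v)) = (h \<otimes> e) \<otimes> (gen v \<otimes> sinv M (gen v))" by (simp only: hc(3))
  also have "\<dots> = h \<otimes> (e \<otimes> (\<one> \<otimes> (gen v \<otimes> sinv M (gen v))))" using hc(1) e(1) bc by (simp add: m_assoc)
  also have "\<dots> = h" by (simp only: absorb[OF Q_one]) (simp add: e(1) hc)
  finally have "((None, \<one>), (i, s)) \<in> act h O act (gen v) O act (sinv M (gen v))"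
    using root hc(1) bc by (simp flip: act_mult)
  then obtain a b where "((None, \<one>), a) \<in> act h" "(a, b) \<in> act (gen v)" by blast
  then have "((i, s), b) \<in> arcs v" using act_unique[OF root] v by (simp add: act_gen)
  then consider (inside) "s \<otimes> gen v \<in> S" | (bridge) "i = None" "s \<in> Q"
    unfolding arcs_def by blast
  then show ?thesis
  proof cases
    case bridge
    then show ?thesis using h_eq s by auto
  next
    case inside
    define k where "k = y \<otimes> e"
    have kc: "k \<in> carrier M" using y e by (simp add: k_def)
    have kh: "k \<otimes> h = e" using y e hc by (simp add: k_def m_assoc)
    have ke: "k \<otimes> e = k" using y e by (simp add: k_def m_assoc)
    \<comment> \<open>Acting by \<open>k\<close> is the inverse automorphism. The root of copy \<open>i\<close> has an image \<open>(j, z)\<close>, since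
      \<open>k\<close> ends in \<open>e\<close>, and \<open>e\<close> absorbs the way along \<open>entry i\<close> and back.\<close>
    obtain d where d: "d \<in> carrier M" "e \<otimes> (entry i \<otimes> d) = e"
    proof (cases i)
      case None
      then show ?thesis using that[of \<one>] e by simp
    next
      case (Some q)
      then have q: "q \<in> Q" using i by (auto simp: copies_def)
      then have "e \<otimes> (entry i \<otimes> (sinv M (gen v) \<otimes> inv q)) = e"
        using le[OF q] Some bc Q_carrier Q_inv by (simp add: m_assoc)
      then show ?thesis using that[of "sinv M (gen v) \<otimes> inv q"] q bc Q_carrier Q_inv by simp
    qed
    have "(k \<otimes> entry i \<otimes> d) \<otimes> h = (k \<otimes> e) \<otimes> (entry i \<otimes> d) \<otimes> h"
      using kc ic d(1) hc(1) ke by (simp add: m_assoc)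
    also have "\<dots> = k \<otimes> (e \<otimes> (entry i \<otimes> d)) \<otimes> h" using kc ic d(1) hc(1) e(1) by (simp add: m_assoc)
    also have "\<dots> = e" by (simp add: d(2) ke kh)
    finally have "((None, \<one>), (None, \<one>)) \<in> act (k \<otimes> entry i) O act (d \<otimes> h)"
      using loop kc ic d(1) hc(1) by (simp add: m_assoc flip: act_mult)
    then obtain j z where jz: "((None, \<one>), (j, z)) \<in> act (k \<otimes> entry i)" by auto
    then have "(j, z) \<in> vertices" using act_vertices by blast
    then have j: "j \<in> copies" and z: "z \<in> S" "z \<in> carrier M" using S_carrier by (auto simp: vertices_def)
    \<comment> \<open>Copy \<open>i\<close> is mapped into copy \<open>j\<close>, but \<open>(i, s)\<close> goes to the root and \<open>(i, s \<otimes> gen v)\<close> goes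
      across the bridge at the root.\<close>
    have "k \<otimes> entry i \<otimes> s = k \<otimes> h"
      unfolding h_eq using kc ic s e(1) ke by (simp flip: m_assoc)
    then have returns: "k \<otimes> entry i \<otimes> s = e" using kh by simp
    have stay: "((None, \<one>), (j, z \<otimes> m)) \<in> act (k \<otimes> entry i \<otimes> m)" if "m \<in> S" for m
    proof -
      have "((j, z), (j, z \<otimes> m)) \<in> act m"
        by (rule act_in_copy) (use that j z S_carrier S_mult_closed in auto)
      then show ?thesis using jz kc ic S_carrier[OF that] by (auto simp: act_mult)
    qed
    have "((None, \<one>), (j, z \<otimes> s)) \<in> act e" using stay[OF s(1)] by (simp add: returns)
    then have "j = None" using act_unique loop by blast
    have "k \<otimes> entry i \<otimes> (s \<otimes> gen v) = (k \<otimes> entry i \<otimes> s) \<otimes> gen v"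
      using kc ic s bc by (simp add: m_assoc)
    then have "((None, \<one>), (j, z \<otimes> (s \<otimes> gen v))) \<in> act e O act (gen v)"
      using stay[OF inside] bc e(1) by (simp add: returns act_mult)
    moreover have "((None, \<one>), (Some \<one>, \<one>)) \<in> act e O act (gen v)"
      using loop v Q_one by (auto simp: act_gen arcs_def)
    ultimately have "(j, z \<otimes> (s \<otimes> gen v)) = (Some \<one>, \<one>)"
      using e(1) bc by (intro act_unique[of _ _ "e \<otimes> gen v"]) (simp_all only: act_mult)
    then have "j = Some \<one>" by simp
    then show ?thesis using \<open>j = None\<close> by simp
  qed
qed

text \<open>The map \<open>q \<mapsto> eq\<close> is injective because \<open>eq\<close> moves the root to \<open>(None, q)\<close>.\<close>

lemma maximal_subgroup_iso:
  assumes "finite Q"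
  shows "\<exists>e \<in> carrier M. e \<otimes> e = e \<and> maximal_subgroup M e \<cong> (units_of M)\<lparr>carrier := Q\<rparr>"
proof -
  obtain e where e: "e \<in> carrier M" "e \<otimes> e = e"
    and le: "\<And>q. q \<in> Q \<Longrightarrow> e \<otimes> bridge_idem q = e"
    and comm: "\<And>q. q \<in> Q \<Longrightarrow> q \<otimes> e = e \<otimes> q" and loop: "((None, \<one>), (None, \<one>)) \<in> act e"
    using bridge_meet[OF assms] by blast
  define f where "f q = e \<otimes> q" for q
  have hom: "f (p \<otimes> q) = f p \<otimes> f q" if "p \<in> Q" "q \<in> Q" for p q
  proof -
    have c: "p \<in> carrier M" "q \<in> carrier M" using that Q_carrier by auto
    have "f p \<otimes> f q = e \<otimes> (p \<otimes> e) \<otimes> q" using c e(1) by (simp add: f_def m_assoc)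
    also have "\<dots> = (e \<otimes> e) \<otimes> (p \<otimes> q)" using c e(1) by (simp only: comm[OF that(1)]) (simp add: m_assoc)
    finally show ?thesis by (simp add: f_def e(2))
  qed
  have H: "f q \<in> H_class M e" if q: "q \<in> Q" for q
  proof -
    have c: "q \<in> carrier M" "inv q \<in> carrier M" using q Q_carrier Q_inv by auto
    have "e \<otimes> f q = f q" using c e by (simp add: f_def flip: m_assoc)
    moreover have "f q \<otimes> e = e \<otimes> (q \<otimes> e)" using c e(1) by (simp add: f_def m_assoc)
    then have "f q \<otimes> e = f q" using c e by (simp add: comm[OF q] f_def flip: m_assoc)
    moreover have "f q \<otimes> inv q = e" using c e(1) Q_Units[OF q] by (simp add: f_def m_assoc)
    moreover have "inv q \<otimes> f q = e" using Q_cancel(1)[OF q e(1)] by (simp add: f_def flip: comm[OF q])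
    ultimately show ?thesis unfolding H_class_idem_iff[OF e] using c e(1) by (auto simp: f_def)
  qed
  have reach: "((None, \<one>), (None, q)) \<in> act (f q)" if "q \<in> Q" for q
  proof -
    have "((None, \<one>), (None, q)) \<in> act q"
      using act_in_copy[of q None \<one>] one_in_S Q_S[OF that] Q_carrier[OF that] by (simp add: copies_def)
    then show ?thesis using loop e(1) Q_carrier[OF that] by (auto simp: f_def act_mult)
  qed
  have "inj_on f Q"
    by (rule inj_onI) (use reach act_unique in \<open>metis prod.inject\<close>)
  moreover have "f ` Q = H_class M e"
    using H maximal_subgroup_element[OF e le loop] by (auto simp: f_def)
  ultimately have "f \<in> iso ((units_of M)\<lparr>carrier := Q\<rparr>) (maximal_subgroup M e)"
    by (auto simp: iso_def hom_def bij_betw_def maximal_subgroup_def units_of_mult hom)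
  then have "(units_of M)\<lparr>carrier := Q\<rparr> \<cong> maximal_subgroup M e"
    by (auto simp: is_iso_def)
  moreover have "group ((units_of M)\<lparr>carrier := Q\<rparr>)"
    by (rule subgroup.subgroup_is_group[OF subgroup_Q units_group])
  ultimately show ?thesis using e group.iso_sym by blast
qed

end

theorem theorem7p1:
  fixes X :: "'a set" and R :: "('a word \<times> 'a word) set"
    and M :: "'a word set set monoid" and v :: 'a and Q :: "'a word set set set"
  assumes "special_presentation X R"
    and "M = presented_monoid X R"
    and "v \<in> X"
    and "\<not> left_unit M (presented_elem X R [(v, True)])"
    and "\<not> right_unit M (presented_elem X R [(v, True)])"
    and "subgroup Q (units_of M)"
    and "finite Q"
  shows "\<exists>e \<in> carrier M. e \<otimes>\<^bsub>M\<^esub> e = e \<and>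
           maximal_subgroup M e \<cong> (units_of M)\<lparr>carrier := Q\<rparr>"
proof -
  have "inv_mon M" using inv_mon_presented_monoid assms(2) by blast
  then interpret bridged_copies M X R v Q
    by (intro bridged_copies.intro bridged_copies_axioms.intro assms)
  show ?thesis by (rule maximal_subgroup_iso[OF assms(7)])
qed

end
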